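(* Let $D\subset\mathbb{C}$ be a domain and let $L$ be a straight line which divides $D$ into two subdomains $D^+$ and $D^-$. Let $\mathcal{F}$ be a family of functions holomorphic in $D$ which do not have zeros in $D$ and for which all $1$-points lie on $L$. Suppose that $\mathcal{F}$ is not normal at $z_0\in D\cap L$ and let $(f_k)$ be a sequence in $\mathcal{F}$ which does not have a subsequence converging in any neighborhood of $z_0$. Suppose that $(f_k|_{D^+})$ converges. Let $r>0$ with $\overline{D}(z_0,r)\subset D$. Then for all sufficiently large $k$ there exists a $1$-point $a_k$ of $f_k$ such that $a_k\to z_0$ as $k\to\infty$ and such that, if $M_k$ is the line orthogonal to $L$ which intersects $L$ at $a_k$, then $|f_k(z)|\neq 1$ for all $z\in \left(M_k\cap\overline{D}(z_0,r)\right)\setminus\{a_k\}$.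
   Context: $\overline{D}(a,r)$ denotes the closed disk of radius $r$ centered at $a\in\mathbb{C}$. A $1$-point of $f$ is a point $z$ in the domain of $f$ with $f(z)=1$. That $L$ divides $D$ into $D^+$ and $D^-$ means that $D\setminus L$ is the disjoint union of the two domains $D^+$ and $D^-$, lying on the two sides of $L$. Convergence of sequences of holomorphic functions means locally uniform convergence with respect to the spherical metric, so the limit $\infty$ is allowed. A family is normal at a point if it is normal in some neighborhood of that point, i.e. every sequence in the family has a subsequence converging in this sense there. *)

theory Defs
  imports "HOL-Complex_Analysis.Complex_Analysis"
begin

definition domain :: "complex set \<Rightarrow> bool" where
  "domain D \<longleftrightarrow> open D \<and> connected D \<and> D \<noteq> {}"

(* The straight line through p with direction v; only meant for v \<noteq> 0. *)
definition line :: "complex \<Rightarrow> complex \<Rightarrow> complex set" where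
  "line p v = {p + of_real t * v | t :: real. True}"

(* The open half-plane to the left of line p v. The other side is left_side p (- v). *)
definition left_side :: "complex \<Rightarrow> complex \<Rightarrow> complex set" where
  "left_side p v = {z. Im ((z - p) / v) > 0}"

definition divides :: "complex \<Rightarrow> complex \<Rightarrow> complex set \<Rightarrow> complex set \<Rightarrow> complex set \<Rightarrow> bool" where
  "divides p v D Dplus Dminus \<longleftrightarrow>
     domain Dplus \<and> domain Dminus \<and>
     D - line p v = Dplus \<union> Dminus \<and> Dplus \<inter> Dminus = {} \<and>
     (Dplus \<subseteq> left_side p v \<and> Dminus \<subseteq> left_side p (- v) \<or>
      Dplus \<subseteq> left_side p (- v) \<and> Dminus \<subseteq> left_side p v)"

(* The Riemann sphere is complex option, with None as the point at infinity.
   It is identified with the unit sphere of complex \<times> real by inverse stereographic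
   projection from the north pole (0, 1). *)
fun sphere_point :: "complex option \<Rightarrow> complex \<times> real" where
  "sphere_point None = (0, 1)"
| "sphere_point (Some z) =
     (of_real (2 / (1 + (norm z)\<^sup>2)) * z, ((norm z)\<^sup>2 - 1) / ((norm z)\<^sup>2 + 1))"

(* Great-circle distance, i.e. the angle between the two unit vectors. *)
definition spherical_dist :: "complex option \<Rightarrow> complex option \<Rightarrow> real" where
  "spherical_dist x y = arccos (sphere_point x \<bullet> sphere_point y)"

(* The limit g takes values in the sphere, so g = (\<lambda>_. None) is allowed. *)
definition converges_on :: "(nat \<Rightarrow> complex \<Rightarrow> complex) \<Rightarrow> complex set \<Rightarrow> bool" where
  "converges_on f U \<longleftrightarrow>
     (\<exists>g :: complex \<Rightarrow> complex option. \<forall>z\<in>U. \<exists>V. open V \<and> z \<in> V \<and> V \<subseteq> U \<and>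
        (\<forall>e>0. \<forall>\<^sub>F n in sequentially. \<forall>w\<in>V. spherical_dist (Some (f n w)) (g w) < e))"

definition normal_at :: "(complex \<Rightarrow> complex) set \<Rightarrow> complex set \<Rightarrow> complex \<Rightarrow> bool" where
  "normal_at F D z \<longleftrightarrow>
     (\<exists>U. open U \<and> z \<in> U \<and> U \<subseteq> D \<and>
        (\<forall>f :: nat \<Rightarrow> complex \<Rightarrow> complex. range f \<subseteq> F \<longrightarrow>
           (\<exists>s :: nat \<Rightarrow> nat. strict_mono s \<and> converges_on (f \<circ> s) U)))"

end

theory Submission
  imports Defs
begin

text \<open>
  Choose coordinates in which z0 is the origin and the line is the real axis. On a disk around the
  origin every \<open>f k\<close> is zero-free, so \<open>f k = exp (2 \<pi> i g k)\<close> with \<open>g k\<close> holomorphic. The \<open>1\<close>-points of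
  \<open>f k\<close> are the points where \<open>g k\<close> is an integer, and \<open>\<bar>f k z\<bar> = 1\<close> means that \<open>g k z\<close> is real. So \<open>g k\<close>
  takes integer values on the real axis only, and the question is where it takes real values.

  The idea is to normalise \<open>g k\<close> instead of \<open>f k\<close>. For a positive integer m the function \<open>g k / m\<close> omits
  0 and 1 off the real axis, whatever the size of \<open>g k\<close>; Schottky's theorem therefore bounds \<open>g k\<close> on
  a smaller disk linearly by its value at the centre (\<open>schottky_omitting_integers\<close>). A chain of such
  disks shows that \<open>g k z\<close> grows at most like a power of \<open>1 / \<bar>Im z\<bar>\<close> at the real axis, and the maximum
  principle turns this into a bound across the axis (\<open>bound_across_real_axis\<close>). The bound is a
  constant times \<open>M k\<close>, where \<open>M k\<close> is the sum of 1 and the moduli of \<open>g k\<close> at two points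
  \<open>\<plusminus> i R / 2\<close>. Hence the functions \<open>g k / M k\<close> form a normal family; let G be a limit.

  If \<open>M k\<close> stayed bounded along a subsequence, a subsequence of \<open>f k\<close> would converge near the
  origin, against the hypothesis. So \<open>M k\<close> tends to infinity and the values \<open>j / M k\<close> (j an integer)
  become dense in the real line. By Hurwitz's theorem a nonconstant G then takes real values on the real axis only
  (\<open>integer_points_accumulate\<close>). Were \<open>Im (G 0)\<close> nonzero, \<open>\<bar>f k\<bar> = exp (-2 \<pi> Im (g k))\<close> would tend
  to 0 or to infinity near the origin. Thus \<open>G 0\<close> is real, and G is nonconstant because of the
  normalisation \<open>0 \<le> Re (g k (i R / 2)) \<le> 1\<close>. A map that takes real values on the real axis only
  cannot branch at the origin, so \<open>G' 0\<close> is real and nonzero (\<open>deriv_real_of_real_preimages_real\<close>).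

  Finally Hurwitz's theorem yields points a near the origin at which \<open>g k\<close> is an integer. On the
  perpendicular through a, \<open>Im (g k)\<close> is strictly monotone close to a because \<open>Re (G' / G' 0)\<close> is
  positive there, and it is nonzero at the points away from the real axis because \<open>Im G\<close> is
  (\<open>perpendicular_through_integer_point\<close>).
\<close>

section \<open>Growth of holomorphic functions with real integer points\<close>

text \<open>
  If m is a positive integer with \<open>m \<ge> \<bar>g c\<bar>\<close>, then \<open>g / m\<close> omits 0 and 1 and is bounded by 1 at the
  centre, so Schottky's theorem bounds it by an absolute constant. Since m is comparable to
  \<open>\<bar>g c\<bar> + 1\<close>, the estimate is linear in \<open>\<bar>g c\<bar>\<close>, and this is what makes it worth iterating.
\<close>
lemma schottky_omitting_integers:
  obtains C :: real where "C \<ge> 1"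
    "\<And>g c \<rho> z. \<lbrakk>\<rho> > 0; g holomorphic_on ball c \<rho>; \<And>w. w \<in> ball c \<rho> \<Longrightarrow> g w \<notin> \<int>;
        dist c z \<le> \<rho> / 2\<rbrakk> \<Longrightarrow> norm (g z) + 1 \<le> C * (norm (g c) + 1)"
proof
  define B where "B = exp (pi * exp (pi * (2 + 2 * 1 + 12 * (2/3) / (1 - (2/3)))))"
  have "B \<ge> 0" by (simp add: B_def)
  show "B + 1 \<ge> 1" using \<open>B \<ge> 0\<close> by simp
  fix g :: "complex \<Rightarrow> complex" and c z :: complex and \<rho> :: real
  assume \<rho>: "\<rho> > 0" and hol: "g holomorphic_on ball c \<rho>"
    and ni: "\<And>w. w \<in> ball c \<rho> \<Longrightarrow> g w \<notin> \<int>" and z: "dist c z \<le> \<rho> / 2"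
  define m where "m = \<lfloor>norm (g c)\<rfloor> + 1"
  have m: "real_of_int m \<ge> norm (g c)" "real_of_int m \<le> norm (g c) + 1" "m \<ge> 1"
    unfolding m_def by (simp_all add: algebra_simps real_of_int_floor_add_one_ge) (linarith?)
  define h where "h = (\<lambda>w. g (c + of_real (3/4 * \<rho>) * w) / of_int m)"
  have in_ball: "c + of_real (3/4 * \<rho>) * w \<in> ball c \<rho>" if "w \<in> cball 0 1" for w
  proof -
    have "norm (of_real (3/4 * \<rho>) * w) = 3/4 * \<rho> * norm w" using \<rho> by (simp add: norm_mult)
    also have "\<dots> \<le> 3/4 * \<rho> * 1" using that \<rho> by (intro mult_left_mono) auto
    also have "\<dots> < \<rho>" using \<rho> by simp
    finally show ?thesis by (simp add: dist_norm)
  qed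
  have "norm (h (of_real (4 / (3 * \<rho>)) * (z - c))) \<le> B"
    unfolding B_def
  proof (rule Schottky[of h 1 "2/3"])
    have "(g \<circ> (\<lambda>w. c + of_real (3/4 * \<rho>) * w)) holomorphic_on cball 0 1"
      using in_ball by (intro holomorphic_on_compose_gen[OF _ hol] holomorphic_intros) auto
    then show "h holomorphic_on cball 0 1"
      unfolding h_def o_def using m(3) by (intro holomorphic_intros) auto
    show "norm (h 0) \<le> 1" using m by (simp add: h_def norm_divide field_simps)
    show "\<not> (h w = 0 \<or> h w = 1)" if "w \<in> cball 0 1" for w
    proof
      assume "h w = 0 \<or> h w = 1"
      then have "g (c + of_real (3/4 * \<rho>) * w) = 0 \<or> g (c + of_real (3/4 * \<rho>) * w) = of_int m"
        using m(3) by (auto simp: h_def field_simps)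
      with ni[OF in_ball[OF that]] show False
        by (metis Ints_0 Ints_of_int)
    qed
    have "norm (of_real (4 / (3 * \<rho>)) * (z - c)) = 4 / (3 * \<rho>) * dist c z"
      unfolding norm_mult norm_of_real dist_norm norm_minus_commute[of c z] using \<rho> by simp
    also have "\<dots> \<le> 4 / (3 * \<rho>) * (\<rho> / 2)" using \<rho> z by (intro mult_left_mono) auto
    finally show "norm (of_real (4 / (3 * \<rho>)) * (z - c)) \<le> 2/3" using \<rho> by simp
  qed auto
  moreover have "c + of_real (3/4 * \<rho>) * (of_real (4 / (3 * \<rho>)) * (z - c)) = z"
    using \<rho> by (simp add: field_simps)
  ultimately have "norm (g z / of_int m) \<le> B" by (simp only: h_def)
  then have "norm (g z) \<le> B * m" using m(3) by (simp add: norm_divide divide_le_eq)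
  also have "\<dots> \<le> B * (norm (g c) + 1)" using m \<open>B \<ge> 0\<close> by (intro mult_left_mono) auto
  finally have "norm (g z) + 1 \<le> B * (norm (g c) + 1) + (norm (g c) + 1)"
    by (rule add_mono) auto
  also have "\<dots> = (B + 1) * (norm (g c) + 1)" by (simp only: distrib_right mult_1)
  finally show "norm (g z) + 1 \<le> (B + 1) * (norm (g c) + 1)" .
qed

text \<open>
  Moving from b towards a point w of U, the distance to the boundary is at least \<open>d t\<close>. So one can
  pass from the parameter t to \<open>q t\<close> inside half of a disk contained in U, at the cost of the constant
  factor C from \<open>schottky_omitting_integers\<close>. About \<open>ln (1 / t) / ln (1 / q)\<close> steps are needed, and the accumulated
  factor is a power of \<open>1 / t\<close>. The constants do not depend on g.
\<close>
lemma polynomial_growth_convex: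
  fixes b :: complex
  assumes "d > 0" and "convex U" and "bounded U" and "ball b d \<subseteq> U"
  obtains A p where "A > 0" "p > 0"
    "\<And>g w t. \<lbrakk>g holomorphic_on U; \<And>z. z \<in> U \<Longrightarrow> g z \<notin> \<int>; w \<in> U; 0 < t; t \<le> 1\<rbrakk> \<Longrightarrow>
        (norm (g ((1 - t) *\<^sub>R w + t *\<^sub>R b)) + 1) * t ^ p \<le> A * (norm (g b) + 1)"
proof -
  obtain C where C: "C \<ge> 1"
    "\<And>g c \<rho> z. \<lbrakk>\<rho> > 0; g holomorphic_on ball c \<rho>; \<And>w. w \<in> ball c \<rho> \<Longrightarrow> g w \<notin> \<int>;
        dist c z \<le> \<rho> / 2\<rbrakk> \<Longrightarrow> norm (g z) + 1 \<le> C * (norm (g c) + 1)"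
    using schottky_omitting_integers by blast
  obtain K where K: "K > 0" "\<And>z w. z \<in> U \<Longrightarrow> w \<in> U \<Longrightarrow> dist z w \<le> K"
  proof
    show "max 1 (diameter U) > 0" by simp
    show "dist z w \<le> max 1 (diameter U)" if "z \<in> U" "w \<in> U" for z w
      using diameter_bounded_bound[OF \<open>bounded U\<close> that] by linarith
  qed
  have "b \<in> U" using assms by auto
  define q where "q = 1 - min (1/2) (d / (2 * K))"
  have q: "0 < q" "q < 1" "(1 - q) * K \<le> d / 2"
  proof -
    have "0 < d / (2 * K)" using \<open>d > 0\<close> \<open>K > 0\<close> by simp
    then show "0 < q" "q < 1" by (auto simp: q_def)
    have "(1 - q) * K \<le> d / (2 * K) * K" 
      using \<open>K > 0\<close> by (intro mult_right_mono) (auto simp: q_def)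
    then show "(1 - q) * K \<le> d / 2" using \<open>K > 0\<close> by simp
  qed
  \<comment> \<open>the exponent for which a single step loses nothing: C is compensated by \<open>q\<^sup>p\<close>;
      one more factor q makes the exponent positive\<close>
  obtain p where p: "q ^ p < 1 / C"
    using real_arch_pow_inv[of "1 / C" q] q C(1) by auto
  have Cq: "C * q ^ Suc p \<le> 1"
  proof -
    have "q ^ Suc p \<le> q ^ p" using q by (simp add: mult_le_cancel_right1)
    also have "\<dots> \<le> 1 / C" using p by simp
    finally show ?thesis using C(1) by (simp add: field_simps)
  qed
  show ?thesis
  proof (rule that[of C "Suc p"])
    fix g w t
    assume hol: "g holomorphic_on U" and ni: "\<And>z. z \<in> U \<Longrightarrow> g z \<notin> \<int>" and w: "w \<in> U"
      and t: "0 < t" "t \<le> (1::real)"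
    define c where "c = (\<lambda>t. (1 - t) *\<^sub>R w + t *\<^sub>R b)"
    \<comment> \<open>this disk consists of convex combinations of w and points of \<open>ball b d\<close>\<close>
    have sub: "ball (c t) (t * d) \<subseteq> U" if "0 < t" "t \<le> 1" for t
    proof
      fix x assume x: "x \<in> ball (c t) (t * d)"
      define y where "y = b + (1 / t) *\<^sub>R (x - c t)"
      have "norm ((1 / t) *\<^sub>R (x - c t)) < d"
        using x that unfolding norm_scaleR
      by (simp add: dist_norm norm_minus_commute divide_less_eq mult.commute)
      then have "y \<in> U" using assms(4) by (auto simp: y_def dist_norm)
      moreover have "x = (1 - t) *\<^sub>R w + t *\<^sub>R y"
        using that by (simp add: y_def c_def algebra_simps)
      ultimately show "x \<in> U" using w \<open>convex U\<close> that by (auto simp: convex_alt)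
    qed
    have step: "norm (g (c t)) + 1 \<le> C * (norm (g (c t0)) + 1)"
      if "0 < t" "t \<le> t0" "t0 \<le> 1" "q * t0 \<le> t" for t t0
    proof (rule C(2)[where g = g and c = "c t0" and \<rho> = "t0 * d"])
      show "0 < t0 * d" using that \<open>d > 0\<close> by simp
      show "g holomorphic_on ball (c t0) (t0 * d)"
        using sub[of t0] that hol holomorphic_on_subset by force
      show "g z \<notin> \<int>" if "z \<in> ball (c t0) (t0 * d)" for z
        using sub[of t0] that ni \<open>0 < t\<close> \<open>t \<le> t0\<close> \<open>t0 \<le> 1\<close> by force
      have "c t0 - c t = (t0 - t) *\<^sub>R (b - w)" by (simp add: c_def algebra_simps)
      then have "dist (c t0) (c t) = (t0 - t) * dist b w"
        using that by (simp add: dist_norm)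
      also have "\<dots> \<le> (t0 * (1 - q)) * K"
        using that K(2)[OF \<open>b \<in> U\<close> w] q by (intro mult_mono) (auto simp: algebra_simps)
      also have "\<dots> \<le> t0 * (d / 2)"
        using q(3) that by (simp add: mult.assoc mult_left_mono)
      finally show "dist (c t0) (c t) \<le> t0 * d / 2" by simp
    qed
    have "\<forall>t. q ^ n \<le> t \<and> t \<le> 1 \<longrightarrow> (norm (g (c t)) + 1) * t ^ Suc p \<le> C * (norm (g b) + 1)" for n
    proof (induction n)
      case 0
      have "c 1 = b" by (simp add: c_def)
      have "1 * (norm (g b) + 1) \<le> C * (norm (g b) + 1)"
        using C(1) by (intro mult_right_mono) auto
      then show ?case
        using \<open>c 1 = b\<close> by auto
    next
      case (Suc n)
      show ?case
      proof (intro allI impI, elim conjE)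
        fix t assume tq: "q ^ Suc n \<le> t" and t1: "t \<le> 1"
        have t0: "t > 0" using tq q(1) by (smt (verit) zero_less_power)
        show "(norm (g (c t)) + 1) * t ^ Suc p \<le> C * (norm (g b) + 1)"
        proof (cases "t < q")
          case True
          define s where "s = t / q"
          have s: "q ^ n \<le> s" "s \<le> 1" "t \<le> s" "t = q * s"
            using True tq q t0 by (auto simp: s_def field_simps mult_le_cancel_left1)
          have "(norm (g (c t)) + 1) * t ^ Suc p \<le> (C * (norm (g (c s)) + 1)) * t ^ Suc p"
            using step[of t s] s t0 q by (intro mult_right_mono) auto
          also have "\<dots> = (C * q ^ Suc p) * ((norm (g (c s)) + 1) * s ^ Suc p)"
            by (simp add: s(4) power_mult_distrib)
          also have "\<dots> \<le> 1 * ((norm (g (c s)) + 1) * s ^ Suc p)"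
            using Cq s(3) t0 by (intro mult_right_mono) auto
          also have "\<dots> \<le> C * (norm (g b) + 1)"
            using Suc s by auto
          finally show ?thesis .
        next
          case False
          have "t ^ Suc p \<le> 1" using t0 t1 by (intro power_le_one) auto
          then have "(norm (g (c t)) + 1) * t ^ Suc p \<le> (norm (g (c t)) + 1) * 1"
            by (intro mult_left_mono) auto
          also have "\<dots> \<le> C * (norm (g (c 1)) + 1)"
            using step[of t 1] False t0 t1 by auto
          finally show ?thesis by (simp add: c_def)
        qed
      qed
    qed
    moreover obtain n where "q ^ n < t" using real_arch_pow_inv t q by blast
    ultimately show "(norm (g ((1 - t) *\<^sub>R w + t *\<^sub>R b)) + 1) * t ^ Suc p \<le> C * (norm (g b) + 1)"
      using t by (metis c_def less_imp_le)
  qed (use C(1) in auto)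
qed

text \<open>
  \<open>polynomial_growth_convex\<close> in the upper half of the disk: a point z of height y is reached from b
  at a parameter t proportional to y, on a segment that ends at a point w of the half disk.
\<close>
lemma blow_up_at_real_axis:
  assumes "0 < \<rho>" "\<rho> < R"
  obtains A p where "A > 0" "p > 0"
    "\<And>g z. \<lbrakk>g holomorphic_on ball 0 R; \<And>z. z \<in> ball 0 R \<Longrightarrow> g z \<in> \<int> \<Longrightarrow> Im z = 0;
        norm z \<le> \<rho>; Im z > 0\<rbrakk> \<Longrightarrow>
        norm (g z) * Im z ^ p \<le> A * (norm (g (\<i> * of_real (R/2))) + 1)"
proof -
  define U where "U = ball 0 R \<inter> {z. Im z > 0}"
  define b where "b = \<i> * of_real (R/2)"
  have nb: "norm b = R/2" "Im b = R/2" using assms by (auto simp: b_def norm_mult)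
  have "R / 2 > 0" using assms by simp
  moreover have "convex U" unfolding U_def by (intro convex_Int convex_ball convex_halfspace_Im_gt)
  moreover have "bounded U" by (auto simp: U_def)
  moreover have "ball b (R/2) \<subseteq> U"
  proof
    fix z assume z: "z \<in> ball b (R/2)"
    have "\<bar>Im (b - z)\<bar> < R/2"
      using abs_Im_le_cmod[of "b - z"] z by (auto simp: dist_norm)
    then have "Im z > 0" using nb by auto
    moreover have "norm z < R" using norm_triangle_ineq2[of z b] z nb by (auto simp: dist_norm norm_minus_commute)
    ultimately show "z \<in> U" by (auto simp: U_def)
  qed
  ultimately obtain A p where Ap: "A > 0" "p > 0"
    "\<And>g w t. \<lbrakk>g holomorphic_on U; \<And>z. z \<in> U \<Longrightarrow> g z \<notin> \<int>; w \<in> U; 0 < t; t \<le> 1\<rbrakk> \<Longrightarrow>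
        (norm (g ((1 - t) *\<^sub>R w + t *\<^sub>R b)) + 1) * t ^ p \<le> A * (norm (g b) + 1)"
    by (rule polynomial_growth_convex) blast
  \<comment> \<open>so small that continuing the segment from b through z by the ratio \<open>\<kappa> Im z\<close> stays in U\<close>
  define \<kappa> where "\<kappa> = (R - \<rho>) / (2 * R * R)"
  have \<kappa>: "\<kappa> > 0" using assms by (simp add: \<kappa>_def)
  show ?thesis
  proof (rule that[of "A / \<kappa> ^ p" p])
    show "A / \<kappa> ^ p > 0" using Ap \<kappa> by simp
    fix g :: "complex \<Rightarrow> complex" and z :: complex
    assume hol: "g holomorphic_on ball 0 R" and re: "\<And>z. z \<in> ball 0 R \<Longrightarrow> g z \<in> \<int> \<Longrightarrow> Im z = 0"
      and z: "norm z \<le> \<rho>" "Im z > 0"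
    define t where "t = \<kappa> * Im z"
    have Imz: "Im z \<le> \<rho>" using z abs_Im_le_cmod[of z] by linarith
    have t0: "t > 0" using z \<kappa> by (simp add: t_def)
    have "t * (2 * R) = (R - \<rho>) * (Im z / R)" using assms by (simp add: t_def \<kappa>_def)
    also have "\<dots> < (R - \<rho>) * 1" using assms Imz by (intro mult_strict_left_mono) auto
    finally have tR: "t * (2 * R) < R - \<rho>" by simp
    have t1: "t < 1"
    proof (rule ccontr)
      assume "\<not> t < 1"
      then have "1 * (2 * R) \<le> t * (2 * R)" using assms by (intro mult_right_mono) auto
      with tR assms show False by simp
    qed
    have "\<kappa> * (R / 2) = (R - \<rho>) / (4 * R)" using assms by (simp add: \<kappa>_def)
    then have "\<kappa> * (R / 2) < 1" using assms by (simp add: divide_less_eq)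
    then have "\<kappa> * (R / 2) * Im z < 1 * Im z" using z by (intro mult_strict_right_mono)
    then have "t * (R / 2) < Im z" by (simp add: t_def mult_ac)
    define w where "w = (1 / (1 - t)) *\<^sub>R (z - t *\<^sub>R b)"
    have "w \<in> U"
    proof -
      have "Im w = (Im z - t * (R / 2)) / (1 - t)" using nb by (simp add: w_def)
      then have "Im w > 0" using t1 \<open>t * (R / 2) < Im z\<close> by simp
      moreover have "norm (z - t *\<^sub>R b) \<le> \<rho> + t * (R / 2)"
        using norm_triangle_ineq4[of z "t *\<^sub>R b"] z nb t0 by auto
      with tR have "norm (z - t *\<^sub>R b) < R * (1 - t)" using t0 assms by (simp add: algebra_simps)
      then have "norm w < R" using t1 unfolding w_def norm_scaleR by (simp add: divide_less_eq)
      ultimately show ?thesis by (simp add: U_def)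
    qed
    have zw: "(1 - t) *\<^sub>R w + t *\<^sub>R b = z" using t1 by (simp add: w_def)
    have "(norm (g z) + 1) * t ^ p \<le> A * (norm (g b) + 1)"
    proof (rule Ap(3)[of g w t, unfolded zw])
      show "g holomorphic_on U" using holomorphic_on_subset[OF hol, of U] by (auto simp: U_def)
      show "g x \<notin> \<int>" if "x \<in> U" for x using that re[of x] by (auto simp: U_def)
    qed (use \<open>w \<in> U\<close> t0 t1 in auto)
    moreover have "norm (g z) * t ^ p \<le> (norm (g z) + 1) * t ^ p"
      using t0 by (intro mult_right_mono) auto
    ultimately have "norm (g z) * (\<kappa> ^ p * Im z ^ p) \<le> A * (norm (g b) + 1)"
      by (simp add: t_def power_mult_distrib)
    then show "norm (g z) * Im z ^ p \<le> A / \<kappa> ^ p * (norm (g (\<i> * of_real (R/2))) + 1)"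
      using \<kappa> by (simp add: b_def pos_le_divide_eq mult_ac)
  qed (use Ap in auto)
qed

text \<open>
  On the circle \<open>\<bar>z\<bar> = \<rho>\<close> the factor \<open>z\<^sup>2 - \<rho>\<^sup>2\<close> has modulus \<open>2 \<rho> \<bar>Im z\<bar>\<close>. Its p-th power cancels the blow-up
  of g at the real axis from both sides, and the maximum principle applies to the product. Only the
  values of g at two points off the real axis enter the bound.
\<close>
lemma bound_across_real_axis:
  assumes "0 < r" "r < R"
  obtains A where "A > 0"
    "\<And>g z. \<lbrakk>g holomorphic_on ball 0 R; \<And>z. z \<in> ball 0 R \<Longrightarrow> g z \<in> \<int> \<Longrightarrow> Im z = 0;
        norm z \<le> r\<rbrakk> \<Longrightarrow>
        norm (g z) \<le> A * (norm (g (\<i> * of_real (R/2))) + norm (g (- (\<i> * of_real (R/2)))) + 1)"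
proof -
  define \<rho> where "\<rho> = (r + R) / 2"
  have \<rho>: "0 < \<rho>" "\<rho> < R" "r < \<rho>" using assms by (auto simp: \<rho>_def)
  define b where "b = \<i> * complex_of_real (R/2)"
  obtain A p where Ap: "A > 0" "p > 0"
    "\<And>g z. \<lbrakk>g holomorphic_on ball 0 R; \<And>z. z \<in> ball 0 R \<Longrightarrow> g z \<in> \<int> \<Longrightarrow> Im z = 0;
        norm z \<le> \<rho>; Im z > 0\<rbrakk> \<Longrightarrow> norm (g z) * Im z ^ p \<le> A * (norm (g b) + 1)"
    using blow_up_at_real_axis[OF \<rho>(1,2)] unfolding b_def by blast
  define \<delta> where "\<delta> = \<rho>\<^sup>2 - r\<^sup>2"
  have \<delta>: "\<delta> > 0" using \<rho> assms by (simp add: \<delta>_def power_strict_mono)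
  show ?thesis
  proof (rule that[of "(2 * \<rho>) ^ p * A / \<delta> ^ p"])
    show "(2 * \<rho>) ^ p * A / \<delta> ^ p > 0" using Ap \<rho> \<delta> by simp
    fix g :: "complex \<Rightarrow> complex" and z :: complex
    assume hol: "g holomorphic_on ball 0 R" and re: "\<And>z. z \<in> ball 0 R \<Longrightarrow> g z \<in> \<int> \<Longrightarrow> Im z = 0"
      and z: "norm z \<le> r"
    define M where "M = norm (g b) + norm (g (- b)) + 1"
    have two_sided: "norm (g w) * \<bar>Im w\<bar> ^ p \<le> A * M" if w: "norm w \<le> \<rho>" for w
    proof -
      consider "Im w > 0" | "Im w = 0" | "Im w < 0" by linarith
      then show ?thesis
      proof cases
        case 1
        have "norm (g w) * Im w ^ p \<le> A * (norm (g b) + 1)" using Ap(3)[OF hol re w 1] .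
        also have "\<dots> \<le> A * M" using Ap(1) by (simp add: M_def)
        finally show ?thesis using 1 by simp
      next
        case 2
        then have "norm (g w) * \<bar>Im w\<bar> ^ p = 0" using Ap(2) by simp
        moreover have "A * M \<ge> 0" using Ap(1) by (simp add: M_def)
        ultimately show ?thesis by linarith
      next
        case 3
        have "(g \<circ> uminus) holomorphic_on ball 0 R"
          by (rule holomorphic_on_compose_gen[OF _ hol]) (auto intro!: holomorphic_intros)
        then have "norm ((g \<circ> uminus) (- w)) * Im (- w) ^ p \<le> A * (norm ((g \<circ> uminus) b) + 1)"
          by (rule Ap(3)) (use 3 w re[of "- _"] in auto)
        also have "\<dots> \<le> A * M" using Ap(1) by (simp add: M_def)
        finally show ?thesis using 3 by simp
      qed
    qed
    have "norm (g z * (z\<^sup>2 - of_real (\<rho>\<^sup>2)) ^ p) \<le> (2 * \<rho>) ^ p * (A * M)"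
    proof (rule maximum_modulus_frontier[of "\<lambda>z. g z * (z\<^sup>2 - of_real (\<rho>\<^sup>2)) ^ p" "cball 0 \<rho>"])
      have sub: "cball 0 \<rho> \<subseteq> ball (0::complex) R" using \<rho> by auto
      have holc: "(\<lambda>z. g z * (z\<^sup>2 - of_real (\<rho>\<^sup>2)) ^ p) holomorphic_on cball 0 \<rho>"
        by (intro holomorphic_intros holomorphic_on_subset[OF hol sub])
      show "(\<lambda>z. g z * (z\<^sup>2 - of_real (\<rho>\<^sup>2)) ^ p) holomorphic_on interior (cball 0 \<rho>)"
        by (rule holomorphic_on_subset[OF holc]) (rule interior_subset)
      show "continuous_on (closure (cball 0 \<rho>)) (\<lambda>z. g z * (z\<^sup>2 - of_real (\<rho>\<^sup>2)) ^ p)"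
        using holomorphic_on_imp_continuous_on[OF holc] by simp
      show "z \<in> cball 0 \<rho>" using z \<rho> by simp
      fix w assume "w \<in> frontier (cball (0::complex) \<rho>)"
      then have w: "norm w = \<rho>" using \<rho> by (auto simp: frontier_cball)
      \<comment> \<open>on the circle \<open>w\<^sup>2 - \<rho>\<^sup>2 = w (w - cnj w)\<close>\<close>
      have "of_real (\<rho>\<^sup>2) = w * cnj w" using w by (simp add: complex_norm_square[symmetric])
      then have "w\<^sup>2 - of_real (\<rho>\<^sup>2) = w * (w - cnj w)" by (simp add: power2_eq_square algebra_simps)
      also have "\<dots> = w * (2 * of_real (Im w) * \<i>)" by (simp add: complex_diff_cnj)
      finally have "norm (w\<^sup>2 - of_real (\<rho>\<^sup>2)) = 2 * \<rho> * \<bar>Im w\<bar>" using w by (simp add: norm_mult)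
      then have "norm (g w * (w\<^sup>2 - of_real (\<rho>\<^sup>2)) ^ p) = (2 * \<rho>) ^ p * (norm (g w) * \<bar>Im w\<bar> ^ p)"
        by (simp add: norm_mult norm_power power_mult_distrib)
      also have "\<dots> \<le> (2 * \<rho>) ^ p * (A * M)"
        using two_sided[of w] w \<rho> by (intro mult_left_mono) auto
      finally show "norm (g w * (w\<^sup>2 - of_real (\<rho>\<^sup>2)) ^ p) \<le> (2 * \<rho>) ^ p * (A * M)" .
    qed simp
    moreover have "\<delta> ^ p \<le> norm (z\<^sup>2 - of_real (\<rho>\<^sup>2)) ^ p"
    proof (rule power_mono)
      have "\<delta> \<le> \<rho>\<^sup>2 - (norm z)\<^sup>2" using z by (simp add: \<delta>_def power_mono)
      also have "\<dots> = norm (of_real (\<rho>\<^sup>2) :: complex) - norm (z\<^sup>2)" by (simp add: norm_power)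
      also have "\<dots> \<le> norm (z\<^sup>2 - of_real (\<rho>\<^sup>2))" by (metis norm_minus_commute norm_triangle_ineq2)
      finally show "\<delta> \<le> norm (z\<^sup>2 - of_real (\<rho>\<^sup>2))" .
    qed (use \<delta> in auto)
    then have "norm (g z) * \<delta> ^ p \<le> norm (g z) * norm (z\<^sup>2 - of_real (\<rho>\<^sup>2)) ^ p"
      by (rule mult_left_mono) auto
    ultimately have "norm (g z) * \<delta> ^ p \<le> (2 * \<rho>) ^ p * (A * M)"
      by (simp add: norm_mult norm_power)
    then have "norm (g z) \<le> (2 * \<rho>) ^ p * A / \<delta> ^ p * M" using \<delta> by (simp add: pos_le_divide_eq mult_ac)
    then show "norm (g z) \<le> (2 * \<rho>) ^ p * A / \<delta> ^ p *
        (norm (g (\<i> * of_real (R/2))) + norm (g (- (\<i> * of_real (R/2)))) + 1)"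
      by (simp add: M_def b_def)
  qed
qed

section \<open>Limits of normalised functions\<close>

text \<open>
  The numbers \<open>\<lfloor>t M k\<rfloor> / M k\<close> tend to \<open>t = G \<zeta>\<close>. If \<open>g k\<close> had no integer value in S for infinitely
  many k, the differences of \<open>g k / M k\<close> and these numbers would have no zeros in S, whereas their limit vanishes
  at \<open>\<zeta>\<close>; this contradicts Hurwitz's theorem.
\<close>
lemma integer_points_accumulate:
  fixes M :: "nat \<Rightarrow> real"
  assumes S: "open S" "connected S"
    and hol: "\<And>k. g k holomorphic_on S" "G holomorphic_on S"
    and M: "\<And>k. M k > 0" "filterlim M at_top sequentially"
    and lim: "\<And>K. \<lbrakk>compact K; K \<subseteq> S\<rbrakk> \<Longrightarrow> uniform_limit K (\<lambda>k z. g k z / of_real (M k)) G sequentially"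
    and nonconst: "\<not> G constant_on S" and \<zeta>: "\<zeta> \<in> S" "Im (G \<zeta>) = 0"
  shows "\<forall>\<^sub>F k in sequentially. \<exists>z\<in>S. g k z \<in> \<int>"
proof (rule ccontr)
  assume "\<not> ?thesis"
  then obtain s :: "nat \<Rightarrow> nat" where s: "strict_mono s" "\<And>n z. z \<in> S \<Longrightarrow> g (s n) z \<notin> \<int>"
    using not_eventually_sequentiallyD by blast
  define t where "t = Re (G \<zeta>)"
  define c where "c = (\<lambda>k. of_int \<lfloor>t * M k\<rfloor> / M k)"
  have "(\<lambda>k. c k) \<longlonglongrightarrow> t"
  proof (rule LIM_zero_cancel, rule Lim_null_comparison[where g = "\<lambda>k. 1 / M k"])
    have "norm (c k - t) \<le> 1 / M k" for k
    proof -
      have "c k - t = (of_int \<lfloor>t * M k\<rfloor> - t * M k) / M k"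
        using M(1)[of k] by (simp add: c_def field_simps)
      moreover have "\<bar>of_int \<lfloor>t * M k\<rfloor> - t * M k\<bar> \<le> 1" by linarith
      ultimately show ?thesis using M(1)[of k] by (simp add: divide_right_mono)
    qed
    then show "\<forall>\<^sub>F k in sequentially. norm (c k - t) \<le> 1 / M k" by simp
    show "(\<lambda>k. 1 / M k) \<longlonglongrightarrow> 0"
      using tendsto_inverse_0_at_top[OF M(2)] by (simp add: inverse_eq_divide)
  qed
  then have "(\<lambda>k. complex_of_real (c (s k))) \<longlonglongrightarrow> of_real t"
    by (intro tendsto_of_real) (rule LIMSEQ_subseq_LIMSEQ[OF _ s(1), unfolded o_def])
  then have c_lim: "uniform_limit K (\<lambda>k z. complex_of_real (c (s k))) (\<lambda>z. of_real t) sequentially" for K :: "complex set"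
    by (auto simp: uniform_limit_iff dest!: tendstoD elim!: eventually_mono)
  define h where "h = (\<lambda>k z. g (s k) z / of_real (M (s k)) - of_real (c (s k)))"
  have "G \<zeta> - of_real t \<noteq> 0"
  proof (rule Hurwitz_no_zeros[OF S, of h "\<lambda>z. G z - of_real t" \<zeta>])
    show "h n holomorphic_on S" for n
      unfolding h_def using M(1)[of "s n"] by (intro holomorphic_intros hol) auto
    show "(\<lambda>z. G z - of_real t) holomorphic_on S" by (intro holomorphic_intros hol)
    show "uniform_limit K h (\<lambda>z. G z - of_real t) sequentially" if "compact K" "K \<subseteq> S" for K
      unfolding h_def
      by (rule uniform_limit_minus[OF filterlim_compose[OF lim[OF that] filterlim_subseq[OF s(1)]] c_lim])
    show "\<not> (\<lambda>z. G z - of_real t) constant_on S"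
      using nonconst by (auto simp: constant_on_def) (metis diff_eq_eq)
    show "h n z \<noteq> 0" if "z \<in> S" for n z
    proof
      assume "h n z = 0"
      then have "g (s n) z = of_real (c (s n) * M (s n))"
        using M(1)[of "s n"] by (simp add: h_def field_simps)
      also have "\<dots> = of_int \<lfloor>t * M (s n)\<rfloor>" using M(1)[of "s n"] by (simp add: c_def)
      finally show False using s(2)[OF that, of n] by simp
    qed
  qed (rule \<zeta>)
  then show False using \<zeta> by (simp add: t_def complex_eq_iff)
qed

text \<open>
  Near the origin \<open>G - G 0 = \<phi>\<^sup>n\<close> with \<open>\<phi>\<close> locally biholomorphic. The preimage under \<open>\<phi>\<close> of each of the
  2n rays on which the n-th power is real must be real, and it leaves the origin in the direction of
  the ray divided by \<open>\<phi>' 0\<close>. For \<open>n \<ge> 2\<close> not all of these directions are real.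
\<close>
lemma deriv_real_of_real_preimages_real:
  assumes hol: "G holomorphic_on ball 0 \<rho>" and "\<rho> > 0"
    and nonconst: "\<not> G constant_on ball 0 \<rho>" and G0: "Im (G 0) = 0"
    and re: "\<And>z. z \<in> ball 0 \<rho> \<Longrightarrow> Im (G z) = 0 \<Longrightarrow> Im z = 0"
  obtains \<alpha> :: real where "\<alpha> \<noteq> 0" "deriv G 0 = of_real \<alpha>"
proof -
  have "(\<lambda>z. G z - G 0) holomorphic_on ball 0 \<rho>" by (intro holomorphic_intros hol)
  moreover have "0 \<in> ball (0::complex) \<rho>" "G 0 - G 0 = 0" using \<open>\<rho> > 0\<close> by auto
  moreover have "\<not> (\<lambda>z. G z - G 0) constant_on ball 0 \<rho>"
    using nonconst by (auto simp: constant_on_def) (metis diff_eq_eq)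
  ultimately have factor: "\<exists>h r n. 0 < n \<and> 0 < r \<and> ball 0 r \<subseteq> ball (0::complex) \<rho> \<and> h holomorphic_on ball 0 r \<and>
      (\<forall>w\<in>ball 0 r. G w - G 0 = (w - 0) ^ n * h w \<and> h w \<noteq> 0)"
    by (rule holomorphic_factor_zero_nonconstant[OF _ open_ball connected_ball]) blast
  obtain h r n where n: "0 < n" and r: "0 < r" "ball 0 r \<subseteq> ball (0::complex) \<rho>"
    and h: "h holomorphic_on ball 0 r" "\<And>w. w \<in> ball 0 r \<Longrightarrow> G w - G 0 = w ^ n * h w"
      "\<And>w. w \<in> ball 0 r \<Longrightarrow> h w \<noteq> 0"
    using factor unfolding diff_0_right by blast
  obtain l where l: "l holomorphic_on ball 0 r" "\<And>w. w \<in> ball 0 r \<Longrightarrow> h w = exp (l w)"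
    using contractible_imp_holomorphic_log[OF h(1) convex_imp_contractible[OF convex_ball] h(3)] by blast
  define E where "E = (\<lambda>w. exp (l w / of_nat n))"
  define \<phi> where "\<phi> = (\<lambda>w. w * E w)"
  have holE: "E holomorphic_on ball 0 r" unfolding E_def using n by (intro holomorphic_intros l) auto
  then have hol\<phi>: "\<phi> holomorphic_on ball 0 r" unfolding \<phi>_def by (intro holomorphic_intros)
  have E_pow: "G w - G 0 = \<phi> w ^ n" if "w \<in> ball 0 r" for w
    using h(2)[OF that] l(2)[OF that] n
    by (simp add: \<phi>_def E_def power_mult_distrib exp_of_nat_mult[symmetric])
  have E_nz: "E w \<noteq> 0" for w by (simp add: E_def)
  have \<phi>_nonconst: "\<not> \<phi> constant_on ball 0 r"
  proof
    assume "\<phi> constant_on ball 0 r"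
    then obtain c where c: "\<And>w. w \<in> ball 0 r \<Longrightarrow> \<phi> w = c" by (auto simp: constant_on_def)
    have "\<phi> 0 = c" "\<phi> (of_real (r/2)) = c" using c r by auto
    then show False using r E_nz by (auto simp: \<phi>_def)
  qed
  \<comment> \<open>\<open>w \<mapsto> w\<^sup>n\<close> maps the ray through u into the real axis; E 0 is the derivative of \<open>\<phi>\<close> at 0\<close>
  have key: "Im (E 0 / u) = 0" if u: "u \<noteq> 0" "Im (u ^ n) = 0" for u
  proof (rule ccontr)
    assume nz: "Im (E 0 / u) \<noteq> 0"
    have "continuous_on (ball 0 r) (\<lambda>w. Im (E w / u))"
      by (intro continuous_intros holomorphic_on_imp_continuous_on[OF holE]) (use u in auto)
    then have "isCont (\<lambda>w. Im (E w / u)) 0"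
      using r by (simp add: continuous_on_eq_continuous_at)
    then obtain e where e: "e > 0" "\<And>w. dist 0 w < e \<Longrightarrow> Im (E w / u) \<noteq> 0"
      using continuous_at_avoid[of 0 "\<lambda>w. Im (E w / u)" 0] nz by blast
    have "open (\<phi> ` ball 0 (min e r))"
      by (rule open_mapping_thm[OF hol\<phi>]) (use \<phi>_nonconst in auto)
    moreover have "0 \<in> \<phi> ` ball 0 (min e r)"
      using e r by (auto simp: \<phi>_def image_iff intro!: bexI[of _ 0])
    ultimately obtain d where d: "d > 0" "ball 0 d \<subseteq> \<phi> ` ball 0 (min e r)"
      by (meson open_contains_ball)
    define t where "t = d / (2 * norm u)"
    have t: "t > 0" using d u by (simp add: t_def)
    have "norm (of_real t * u) = d / 2" unfolding norm_mult norm_of_real using d u by (simp add: t_def)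
    then have "of_real t * u \<in> \<phi> ` ball 0 (min e r)" using d by (intro subsetD[OF d(2)]) simp
    then obtain w where w: "w \<in> ball 0 (min e r)" "\<phi> w = of_real t * u" by (metis imageE)
    have "G w - G 0 = of_real (t ^ n) * u ^ n" using w E_pow by (simp add: power_mult_distrib)
    then have "G w = G 0 + of_real (t ^ n) * u ^ n" by (simp add: algebra_simps)
    then have "Im (G w) = 0" using G0 u by simp
    then have "Im w = 0" using re w r by auto
    then have w_real: "w = of_real (Re w)" by (simp add: complex_eq_iff)
    have "w \<noteq> 0" using w t u by (auto simp: \<phi>_def)
    then have "E w / u = of_real t / w" using w(2) u by (simp add: \<phi>_def field_simps)
    also have "\<dots> = of_real (t / Re w)" using w_real by (metis of_real_divide)
    finally have "Im (E w / u) = 0" by simp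
    then show False using e(2)[of w] w by auto
  qed
  have E0: "Im (E 0) = 0" using key[of 1] by simp
  define u where "u = cis (pi / n)"
  have "u ^ n = -1" using n by (simp add: u_def Complex.DeMoivre)
  then have "Im (E 0 / u) = 0" by (intro key) (auto simp: u_def)
  moreover have "E 0 = of_real (Re (E 0))" using E0 by (simp add: complex_eq_iff)
  then have "E 0 / u = of_real (Re (E 0)) * cis (- (pi / n))"
    unfolding u_def by (metis cis_inverse divide_inverse)
  ultimately have "Re (E 0) * sin (pi / n) = 0" by simp
  moreover have "Re (E 0) \<noteq> 0" using E_nz[of 0] E0 by (auto simp: complex_eq_iff)
  ultimately have "sin (pi / n) = 0" by simp
  have "n = 1"
  proof (rule ccontr)
    assume "n \<noteq> 1"
    then have "pi / n < pi" using n by (simp add: divide_less_eq)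
    then have "sin (pi / n) > 0" using n by (intro sin_gt_zero) auto
    with \<open>sin (pi / n) = 0\<close> show False by simp
  qed
  have "(E has_field_derivative deriv E 0) (at 0)"
    using holomorphic_derivI[OF holE] r by simp
  then have "((\<lambda>w. G 0 + w * E w) has_field_derivative E 0) (at 0)"
    by (auto intro!: derivative_eq_intros)
  then have "(G has_field_derivative E 0) (at 0)"
  proof (rule has_field_derivative_transform_within_open[of _ _ _ "ball 0 r"])
    show "G 0 + w * E w = G w" if "w \<in> ball 0 r" for w
      using E_pow[OF that] \<open>n = 1\<close> by (simp add: \<phi>_def algebra_simps)
  qed (use r in auto)
  then have "deriv G 0 = of_real (Re (E 0))"
    using \<open>E 0 = of_real (Re (E 0))\<close> DERIV_imp_deriv by metis
  with \<open>Re (E 0) \<noteq> 0\<close> show ?thesis by (rule that)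
qed

text \<open>
  Two ranges of y are treated separately. For \<open>\<bar>y\<bar> < \<delta>\<close> the derivative of \<open>g k / M k\<close> is close to the
  real number \<open>\<alpha> = deriv G 0\<close>, so the imaginary part is strictly monotone on the perpendicular and vanishes
  at a only. For \<open>\<bar>y\<bar> \<ge> \<delta>\<close> the points lie in a compact set on which \<open>Im G\<close> is bounded away from 0.
\<close>
lemma perpendicular_through_integer_point:
  fixes M :: "nat \<Rightarrow> real"
  assumes "0 < r" "r < \<rho>"
    and hol: "\<And>k. g k holomorphic_on ball 0 \<rho>" "G holomorphic_on ball 0 \<rho>"
    and re: "\<And>k z. z \<in> ball 0 \<rho> \<Longrightarrow> g k z \<in> \<int> \<Longrightarrow> Im z = 0"
    and M: "\<And>k. M k > 0" "filterlim M at_top sequentially"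
    and lim: "\<And>K. \<lbrakk>compact K; K \<subseteq> ball 0 \<rho>\<rbrakk> \<Longrightarrow> uniform_limit K (\<lambda>k z. g k z / of_real (M k)) G sequentially"
    and nonconst: "\<not> G constant_on ball 0 \<rho>" and G0: "Im (G 0) = 0" and "\<epsilon> > 0"
  shows "\<forall>\<^sub>F k in sequentially. \<exists>a. norm a < \<epsilon> \<and> Im a = 0 \<and> g k a \<in> \<int> \<and>
           (\<forall>y::real. y \<noteq> 0 \<and> norm (a + \<i> * of_real y) \<le> r \<longrightarrow> Im (g k (a + \<i> * of_real y)) \<noteq> 0)"
proof -
  have accumulate: "\<forall>\<^sub>F k in sequentially. \<exists>z\<in>ball \<zeta> e. g k z \<in> \<int>"
    if \<zeta>: "Im (G \<zeta>) = 0" "\<zeta> \<in> ball 0 \<rho>" and e: "e > 0" "ball \<zeta> e \<subseteq> ball 0 \<rho>" for \<zeta> e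
  proof (rule integer_points_accumulate[OF open_ball connected_ball _ _ M])
    show "\<not> G constant_on ball \<zeta> e"
    proof
      assume "G constant_on ball \<zeta> e"
      then have "G constant_on ball 0 \<rho>"
        using e \<zeta> by (intro analytic_continuation'[OF hol(2) open_ball connected_ball e(2) \<zeta>(2)])
           (auto simp: islimpt_ball)
      with nonconst show False by simp
    qed
    show "uniform_limit K (\<lambda>k z. g k z / of_real (M k)) G sequentially" if "compact K" "K \<subseteq> ball \<zeta> e" for K
      using that e by (intro lim) auto
  qed (use \<zeta> e holomorphic_on_subset[OF hol(1) e(2)] holomorphic_on_subset[OF hol(2) e(2)] in auto)
  have G_re: "Im z = 0" if z: "z \<in> ball 0 \<rho>" "Im (G z) = 0" for z
  proof (rule ccontr)
    assume "Im z \<noteq> 0"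
    have "open (ball 0 \<rho> \<inter> {w. Im w \<noteq> 0})"
      by (intro open_Int open_ball open_Collect_neq continuous_intros)
    then obtain e where e: "e > 0" "ball z e \<subseteq> ball 0 \<rho> \<inter> {w. Im w \<noteq> 0}"
      using z \<open>Im z \<noteq> 0\<close> unfolding open_contains_ball by blast
    have "\<forall>\<^sub>F k in sequentially. \<exists>z\<in>ball z e. g k z \<in> \<int>" by (rule accumulate) (use z e in auto)
    then obtain k w where "w \<in> ball z e" "g k w \<in> \<int>"
      using eventually_happens'[OF sequentially_bot] by blast
    then show False using re e by blast
  qed
  have "\<rho> > 0" using assms by simp
  obtain \<alpha> where \<alpha>: "\<alpha> \<noteq> 0" "deriv G 0 = of_real \<alpha>"
    using deriv_real_of_real_preimages_real[OF hol(2) \<open>\<rho> > 0\<close> nonconst G0 G_re] by blast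
  have "continuous_on (ball 0 \<rho>) (\<lambda>z. Re (deriv G z / of_real \<alpha>))"
    by (intro continuous_intros holomorphic_on_imp_continuous_on[OF holomorphic_deriv[OF hol(2)]])
       (use \<alpha> in auto)
  then have "isCont (\<lambda>z. Re (deriv G z / of_real \<alpha>)) 0"
    using \<open>\<rho> > 0\<close> by (simp add: continuous_on_eq_continuous_at)
  then have "\<forall>\<^sub>F z in nhds 0. Re (deriv G z / of_real \<alpha>) > 1/2"
    using \<alpha> by (intro order_tendstoD(1)[of _ 1]) (auto simp: continuous_within tendsto_nhds_iff filterlim_at)
  then obtain d where d: "d > 0" "\<And>z. dist z 0 < d \<Longrightarrow> Re (deriv G z / of_real \<alpha>) > 1/2"
    unfolding eventually_nhds_metric by blast
  define \<delta> where "\<delta> = min (d / 3) (r / 3)"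
  have \<delta>: "\<delta> > 0" "3 * \<delta> \<le> d" "3 * \<delta> \<le> r" using d assms by (auto simp: \<delta>_def)
  define K where "K = cball (0::complex) r \<inter> {z. \<bar>Im z\<bar> \<ge> \<delta>}"
  have "closed {z. \<bar>Im z\<bar> \<ge> \<delta>}" by (intro closed_Collect_le continuous_intros)
  then have "compact K" unfolding K_def by (intro compact_Int_closed compact_cball)
  have K_sub: "K \<subseteq> ball 0 \<rho>" "cball 0 r \<subseteq> ball (0::complex) \<rho>" using assms by (auto simp: K_def)
  obtain c where c: "c > 0" "\<And>z. z \<in> K \<Longrightarrow> c \<le> \<bar>Im (G z)\<bar>"
  proof (cases "K = {}")
    case True
    then show ?thesis using that[of 1] by simp
  next
    case False
    have "continuous_on K (\<lambda>z. \<bar>Im (G z)\<bar>)"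
      by (intro continuous_intros holomorphic_on_imp_continuous_on holomorphic_on_subset[OF hol(2) K_sub(1)])
    then obtain x where x: "x \<in> K" "\<And>z. z \<in> K \<Longrightarrow> \<bar>Im (G x)\<bar> \<le> \<bar>Im (G z)\<bar>"
      using continuous_attains_inf[OF \<open>compact K\<close> False] by blast
    have "Im x \<noteq> 0" using x \<delta> by (auto simp: K_def)
    then have "\<bar>Im (G x)\<bar> > 0" using G_re[of x] x K_sub by auto
    then show ?thesis using that x by blast
  qed
  define \<eta> where "\<eta> = min c (\<bar>\<alpha>\<bar> * \<delta> / 4)"
  have \<eta>: "\<eta> > 0" "\<eta> \<le> c" "\<eta> \<le> \<bar>\<alpha>\<bar> * \<delta> / 4" using c \<alpha> \<delta> by (auto simp: \<eta>_def)
  have "\<forall>\<^sub>F k in sequentially. \<forall>z\<in>cball 0 r. dist (g k z / of_real (M k)) (G z) < \<eta>"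
    using uniform_limitD[OF lim[OF compact_cball K_sub(2)] \<eta>(1)] .
  moreover have "\<forall>\<^sub>F k in sequentially. \<exists>a\<in>ball 0 (min \<epsilon> \<delta>). g k a \<in> \<int>"
    using accumulate[OF G0, of "min \<epsilon> \<delta>"] \<open>\<epsilon> > 0\<close> \<delta> \<open>r < \<rho>\<close> by (force intro: subset_ball)
  ultimately show ?thesis
  proof eventually_elim
    case (elim k)
    from elim(2) obtain a where a: "norm a < \<epsilon>" "norm a < \<delta>" "g k a \<in> \<int>" by auto
    define H where "H = (\<lambda>z. g k z / of_real (M k))"
    have Mk: "M k > 0" by (rule M)
    have holH: "H holomorphic_on ball 0 \<rho>" unfolding H_def using Mk by (intro holomorphic_intros hol) auto
    have "a \<in> ball 0 \<rho>" using a \<delta> assms by auto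
    then have "Im a = 0" using re a by blast
    have close: "norm (H z - G z) < \<eta>" if "norm z \<le> r" for z
      using elim(1) that by (auto simp: H_def dist_norm)
    have slope: "Re (deriv H z / of_real \<alpha>) > 0" if z: "norm z \<le> 2 * \<delta>" for z
    proof -
      have sub: "cball z \<delta> \<subseteq> cball 0 r"
      proof
        fix w assume "w \<in> cball z \<delta>"
        then have "norm (w - z) \<le> \<delta>" by (simp add: dist_norm norm_minus_commute)
        then show "w \<in> cball 0 r" using norm_triangle_ineq[of "w - z" z] z \<delta> by auto
      qed
      have z\<rho>: "z \<in> ball 0 \<rho>" using sub K_sub \<delta> by force
      have diff: "(\<lambda>w. H w - G w) holomorphic_on ball 0 \<rho>" by (intro holomorphic_intros holH hol)
      have sub': "cball z \<delta> \<subseteq> ball 0 \<rho>" using sub K_sub by blast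
      \<comment> \<open>Cauchy's estimate makes the derivatives of H and G close as well\<close>
      have "norm ((deriv ^^ 1) (\<lambda>w. H w - G w) z) \<le> fact 1 * \<eta> / \<delta> ^ 1"
      proof (rule Cauchy_inequality)
        show "(\<lambda>w. H w - G w) holomorphic_on ball z \<delta>"
          using sub' by (intro holomorphic_on_subset[OF diff]) auto
        show "continuous_on (cball z \<delta>) (\<lambda>w. H w - G w)"
          using sub' by (intro holomorphic_on_imp_continuous_on holomorphic_on_subset[OF diff])
        show "norm (H x - G x) \<le> \<eta>" if "norm (z - x) = \<delta>" for x
        proof -
          have "x \<in> cball 0 r" using that sub by (auto simp: dist_norm)
          then show ?thesis using close[of x] by simp
        qed
      qed (use \<delta> in auto)
      moreover have "deriv (\<lambda>w. H w - G w) z = deriv H z - deriv G z"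
        using holomorphic_on_imp_differentiable_at[OF holH open_ball z\<rho>]
          holomorphic_on_imp_differentiable_at[OF hol(2) open_ball z\<rho>] by (rule deriv_diff)
      ultimately have "norm (deriv H z - deriv G z) \<le> \<eta> / \<delta>" by simp
      also have "\<dots> \<le> \<bar>\<alpha>\<bar> / 4" using \<eta> \<delta> by (simp add: field_simps)
      finally have "norm ((deriv H z - deriv G z) / of_real \<alpha>) \<le> 1/4"
        using \<alpha> by (simp add: norm_divide field_simps)
      then have "\<bar>Re ((deriv H z - deriv G z) / of_real \<alpha>)\<bar> \<le> 1/4"
        using abs_Re_le_cmod order_trans by blast
      moreover have "deriv H z / of_real \<alpha> = deriv G z / of_real \<alpha> + (deriv H z - deriv G z) / of_real \<alpha>"
        by (simp add: diff_divide_distrib)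
      then have "Re (deriv H z / of_real \<alpha>) =
          Re (deriv G z / of_real \<alpha>) + Re ((deriv H z - deriv G z) / of_real \<alpha>)"
        by (simp only: plus_complex.sel)
      moreover have "Re (deriv G z / of_real \<alpha>) > 1/2" using z \<delta> by (intro d(2)) auto
      ultimately show ?thesis by linarith
    qed
    have Im_gH: "Im (g k z) = M k * Im (H z)" for z using Mk by (simp add: H_def)
    have "Im (H a) = 0" using a(3) Im_gH[of a] Mk by (auto elim!: Ints_cases)
    have "Im (g k (a + \<i> * of_real y)) \<noteq> 0" if y: "y \<noteq> 0" "norm (a + \<i> * of_real y) \<le> r" for y
    proof -
      define b where "b = a + \<i> * of_real y"
      have "Im (H b) \<noteq> 0"
      proof (cases "\<bar>y\<bar> < \<delta>")
        case True
        have "norm b \<le> norm a + norm (\<i> * of_real y)" unfolding b_def by (rule norm_triangle_ineq)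
        then have "norm b \<le> 2 * \<delta>" using a True by (simp add: norm_mult)
        then have seg: "norm u \<le> 2 * \<delta>" if "u \<in> closed_segment a b" for u
          using closed_segment_subset[of a "cball 0 (2 * \<delta>)" b] that a \<delta> by auto
        \<comment> \<open>the real part of \<open>- i H / \<alpha>\<close> is \<open>Im H / \<alpha>\<close>, as \<open>\<alpha>\<close> is real\<close>
        have "\<exists>u. u \<in> closed_segment a b \<and> Re (- \<i> * H b / of_real \<alpha>) - Re (- \<i> * H a / of_real \<alpha>)
              = Re ((- \<i> * deriv H u / of_real \<alpha>) * (b - a))"
        proof (rule complex_mvt_line)
          fix u assume "u \<in> closed_segment a b"
          then have "u \<in> ball 0 \<rho>" using seg[of u] \<delta> assms by auto
          then have "(H has_field_derivative deriv H u) (at u)"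
            using holomorphic_derivI[OF holH open_ball] by blast
          then show "((\<lambda>z. - \<i> * H z / of_real \<alpha>) has_field_derivative - \<i> * deriv H u / of_real \<alpha>) (at u)"
            by (auto intro!: derivative_eq_intros simp: \<alpha>(1))
        qed
        then obtain u where u: "u \<in> closed_segment a b" "Im (H b) / \<alpha> - Im (H a) / \<alpha> = y * Re (deriv H u / of_real \<alpha>)"
          by (auto simp: b_def)
        then have "Im (H b) / \<alpha> \<noteq> 0"
          using slope[of u] seg[of u] y \<open>Im (H a) = 0\<close> by auto
        then show ?thesis by auto
      next
        case False
        then have "b \<in> K" using y \<open>Im a = 0\<close> by (auto simp: K_def b_def)
        then have "c \<le> \<bar>Im (G b)\<bar>" by (rule c)
        moreover have "\<bar>Im (H b - G b)\<bar> < c"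
          using close[of b] abs_Im_le_cmod[of "H b - G b"] y \<eta> by (auto simp: b_def)
        ultimately show ?thesis by auto
      qed
      then show ?thesis using Mk Im_gH by (simp add: b_def)
    qed
    then show ?case using a \<open>Im a = 0\<close> by blast
  qed
qed

section \<open>Spherical convergence\<close>

lemma arccos_small:
  assumes "e > 0"
  obtains d :: real where "d > 0" "\<And>x. \<lbrakk>0 \<le> x; x < d; x \<le> 2\<rbrakk> \<Longrightarrow> arccos (1 - x) < e"
proof
  define e' where "e' = min e (pi / 2)"
  have e': "0 < e'" "e' \<le> e" "e' < pi" using assms pi_gt_zero unfolding e'_def by linarith+
  show "1 - cos e' > 0" using cos_monotone_0_pi[of 0 e'] e' by simp
  fix x assume x: "0 \<le> x" "x < 1 - cos e'" "x \<le> 2"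
  then have "arccos (1 - x) < arccos (cos e')"
    by (intro arccos_less_arccos) (auto intro: cos_ge_minus_one)
  also have "\<dots> = e'" using e' by (intro arccos_cos) auto
  finally show "arccos (1 - x) < e" using e' by simp
qed

text \<open>
  The chordal distance of the two sphere points is
  \<open>2 \<bar>a - b\<bar> / sqrt ((1 + \<bar>a\<bar>\<^sup>2) (1 + \<bar>b\<bar>\<^sup>2))\<close>, and unit vectors at chordal distance c have inner product
  \<open>1 - c\<^sup>2 / 2\<close>.
\<close>
lemma spherical_dist_finite:
  "spherical_dist (Some a) (Some b) =
     arccos (1 - 2 * (norm (a - b))\<^sup>2 / ((1 + (norm a)\<^sup>2) * (1 + (norm b)\<^sup>2)))"
proof -
  define A B where "A = (norm a)\<^sup>2" and "B = (norm b)\<^sup>2"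
  have AB: "1 + A > 0" "1 + B > 0" by (auto simp: A_def B_def add_pos_nonneg)
  have d: "(norm (a - b))\<^sup>2 = A + B - 2 * (a \<bullet> b)"
    by (simp add: A_def B_def power2_norm_eq_inner inner_diff_left inner_diff_right inner_commute)
  have "sphere_point (Some a) \<bullet> sphere_point (Some b)
      = (2 / (1 + A)) * (2 / (1 + B)) * (a \<bullet> b) + (A - 1) / (A + 1) * ((B - 1) / (B + 1))"
    unfolding sphere_point.simps scaleR_conv_of_real[symmetric] inner_Pair inner_scaleR_left inner_scaleR_right
    by (simp add: A_def B_def)
  also have "\<dots> = (4 * (a \<bullet> b) + (A - 1) * (B - 1)) / ((1 + A) * (1 + B))"
    by (simp add: add_divide_distrib add.commute)
  also have "4 * (a \<bullet> b) + (A - 1) * (B - 1) = (1 + A) * (1 + B) - 2 * (norm (a - b))\<^sup>2"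
    unfolding d by (simp add: algebra_simps)
  also have "\<dots> / ((1 + A) * (1 + B)) = 1 - 2 * (norm (a - b))\<^sup>2 / ((1 + A) * (1 + B))"
    using AB by (simp add: diff_divide_distrib)
  finally show ?thesis by (simp add: spherical_dist_def A_def B_def)
qed

lemma spherical_dist_infinity:
  "spherical_dist (Some a) None = arccos (1 - 2 / ((norm a)\<^sup>2 + 1))"
proof -
  have "(norm a)\<^sup>2 + 1 > 0" by (auto intro: add_nonneg_pos)
  then have "((norm a)\<^sup>2 - 1) / ((norm a)\<^sup>2 + 1) = 1 - 2 / ((norm a)\<^sup>2 + 1)"
    by (simp add: field_simps)
  then show ?thesis by (simp add: spherical_dist_def)
qed

lemma converges_on_uniform_limit:
  assumes "open U" and lim: "uniform_limit U f h sequentially"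
  shows "converges_on f U"
  unfolding converges_on_def
proof (intro exI[of _ "\<lambda>z. Some (h z)"] ballI exI[of _ U] conjI allI impI)
  fix e :: real assume "e > 0"
  then obtain d where d: "d > 0" "\<And>x. \<lbrakk>0 \<le> x; x < d; x \<le> 2\<rbrakk> \<Longrightarrow> arccos (1 - x) < e"
    using arccos_small by blast
  define \<eta> where "\<eta> = min 1 (d / 2)"
  have \<eta>: "\<eta> > 0" using d by (simp add: \<eta>_def)
  have "\<forall>\<^sub>F n in sequentially. \<forall>w\<in>U. dist (f n w) (h w) < \<eta>"
    using uniform_limitD[OF lim \<eta>] .
  then show "\<forall>\<^sub>F n in sequentially. \<forall>w\<in>U. spherical_dist (Some (f n w)) (Some (h w)) < e"
  proof eventually_elim
    case (elim n)
    show ?case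
    proof
      fix w assume "w \<in> U"
      define a b where "a = f n w" and "b = h w"
      have ab: "norm (a - b) < \<eta>" using elim \<open>w \<in> U\<close> by (auto simp: a_def b_def dist_norm)
      define x where "x = 2 * (norm (a - b))\<^sup>2 / ((1 + (norm a)\<^sup>2) * (1 + (norm b)\<^sup>2))"
      have "1 * 1 \<le> (1 + (norm a)\<^sup>2) * (1 + (norm b)\<^sup>2)" by (intro mult_mono) auto
      then have "x \<le> 2 * (norm (a - b))\<^sup>2 / 1"
        unfolding x_def by (intro divide_left_mono) auto
      also have "(norm (a - b))\<^sup>2 \<le> norm (a - b) * 1"
        unfolding power2_eq_square using ab by (intro mult_left_mono) (auto simp: \<eta>_def)
      finally have "x < d" "x \<le> 2" using ab by (auto simp: \<eta>_def)
      moreover have "x \<ge> 0" by (simp add: x_def)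
      ultimately show "spherical_dist (Some (f n w)) (Some (h w)) < e"
        using d(2)[of x] by (simp add: spherical_dist_finite a_def b_def x_def)
    qed
  qed
qed (use assms in auto)

lemma converges_on_infinity:
  assumes "open U" and lim: "\<And>B. \<forall>\<^sub>F n in sequentially. \<forall>w\<in>U. norm (f n w) > B"
  shows "converges_on f U"
  unfolding converges_on_def
proof (intro exI[of _ "\<lambda>z. None"] ballI exI[of _ U] conjI allI impI)
  fix e :: real assume "e > 0"
  then obtain d where d: "d > 0" "\<And>x. \<lbrakk>0 \<le> x; x < d; x \<le> 2\<rbrakk> \<Longrightarrow> arccos (1 - x) < e"
    using arccos_small by blast
  show "\<forall>\<^sub>F n in sequentially. \<forall>w\<in>U. spherical_dist (Some (f n w)) None < e"
    using lim[of "max 1 (2 / d)"]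
  proof eventually_elim
    case (elim n)
    show ?case
    proof
      fix w assume "w \<in> U"
      define a where "a = f n w"
      have a: "norm a > 1" "norm a > 2 / d" using elim \<open>w \<in> U\<close> by (auto simp: a_def)
      have "norm a * 1 \<le> (norm a)\<^sup>2" unfolding power2_eq_square using a by (intro mult_left_mono) auto
      then have "(norm a)\<^sup>2 + 1 > 2 / d" "(norm a)\<^sup>2 + 1 > 1" using a by linarith+
      moreover define N where "N = (norm a)\<^sup>2 + 1"
      ultimately have "N > 2 / d" "N > 1" by simp_all
      then have "2 / N < d" "2 / N \<le> 2"
        using d(1) by (auto simp: pos_divide_less_eq pos_divide_le_eq mult.commute)
      then show "spherical_dist (Some (f n w)) None < e"
        using d(2)[of "2 / N"] \<open>N > 1\<close> by (simp add: spherical_dist_infinity a_def N_def)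
    qed
  qed
qed (use assms in auto)

lemma subsequence_converges_of_bounded:
  assumes "0 < \<delta>" "\<delta> < r" and hol: "\<And>k. f k holomorphic_on ball 0 r"
    and bound: "\<And>k z. norm z < r \<Longrightarrow> norm (f k z) \<le> B"
  obtains s :: "nat \<Rightarrow> nat" where "strict_mono s" "converges_on (f \<circ> s) (ball 0 \<delta>)"
proof -
  obtain h s where s: "strict_mono (s :: nat \<Rightarrow> nat)"
    "\<And>K. \<lbrakk>compact K; K \<subseteq> ball 0 r\<rbrakk> \<Longrightarrow> uniform_limit K (f \<circ> s) h sequentially"
  proof (rule Montel[of "ball 0 r" "range f" f])
    show "\<exists>B. \<forall>h\<in>range f. \<forall>z\<in>K. norm (h z) \<le> B" if "compact K" "K \<subseteq> ball 0 r" for K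
      using that bound by (intro exI[of _ B]) (auto simp: subset_iff)
  qed (use hol in auto)
  have "uniform_limit (cball 0 \<delta>) (f \<circ> s) h sequentially" using assms by (intro s(2)) auto
  then have "uniform_limit (ball 0 \<delta>) (f \<circ> s) h sequentially"
    by (rule uniform_limit_on_subset) auto
  then show ?thesis using that[OF s(1)] converges_on_uniform_limit by blast
qed

text \<open>
  The logarithms of the moduli are of exact order \<open>M k\<close> and have the same sign on all of U, so the
  functions tend uniformly to 0 if \<open>\<sigma>\<close> is positive and to infinity if \<open>\<sigma>\<close> is negative.
\<close>
lemma converges_on_of_log_modulus:
  assumes "open U" and M: "filterlim M at_top sequentially" and "\<sigma> \<noteq> 0"
    and norm_f: "\<And>k z. z \<in> U \<Longrightarrow> norm (f k z) = exp (- (2 * pi * L k z))"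
    and near: "\<forall>\<^sub>F k in sequentially. \<forall>z\<in>U. \<bar>L k z - \<sigma> * M k\<bar> \<le> \<bar>\<sigma>\<bar> / 2 * M k"
  shows "converges_on f U"
proof (cases "\<sigma> < 0")
  case True
  show ?thesis
  proof (rule converges_on_infinity[OF \<open>open U\<close>])
    fix B :: real
    have pos: "pi * \<bar>\<sigma>\<bar> > 0" using True by (intro mult_pos_pos) auto
    have "\<forall>\<^sub>F k in sequentially. ln (\<bar>B\<bar> + 1) / (pi * \<bar>\<sigma>\<bar>) < M k"
      using M by (auto simp: filterlim_at_top_dense)
    with near show "\<forall>\<^sub>F k in sequentially. \<forall>z\<in>U. norm (f k z) > B"
    proof eventually_elim
      case (elim k)
      show ?case
      proof
        fix z assume z: "z \<in> U"
        have "\<bar>L k z - \<sigma> * M k\<bar> \<le> \<bar>\<sigma>\<bar> / 2 * M k" using elim(1) z by blast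
        then have "\<bar>\<sigma>\<bar> / 2 * M k \<le> - L k z" using True by (simp add: abs_le_iff)
        then have "2 * pi * (\<bar>\<sigma>\<bar> / 2 * M k) \<le> 2 * pi * - L k z" by (rule mult_left_mono) simp
        then have "M k * (pi * \<bar>\<sigma>\<bar>) \<le> - (2 * pi * L k z)" by (simp only: mult_minus_right) (simp add: mult_ac)
        moreover have "ln (\<bar>B\<bar> + 1) < M k * (pi * \<bar>\<sigma>\<bar>)"
          using elim(2) unfolding pos_divide_less_eq[OF pos] .
        ultimately have "ln (\<bar>B\<bar> + 1) < - (2 * pi * L k z)" by linarith
        then have "exp (ln (\<bar>B\<bar> + 1)) < norm (f k z)" unfolding norm_f[OF z] exp_less_cancel_iff .
        then show "norm (f k z) > B" by simp
      qed
    qed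
  qed
next
  case False
  then have \<sigma>: "\<sigma> > 0" using \<open>\<sigma> \<noteq> 0\<close> by simp
  have "uniform_limit U f (\<lambda>_. 0) sequentially"
    unfolding uniform_limit_iff
  proof (intro allI impI)
    fix e :: real assume "e > 0"
    have pos: "pi * \<sigma> > 0" using \<sigma> by simp
    have "\<forall>\<^sub>F k in sequentially. - ln e / (pi * \<sigma>) < M k"
      using M by (auto simp: filterlim_at_top_dense)
    with near show "\<forall>\<^sub>F k in sequentially. \<forall>z\<in>U. dist (f k z) 0 < e"
    proof eventually_elim
      case (elim k)
      show ?case
      proof
        fix z assume z: "z \<in> U"
        have "\<bar>L k z - \<sigma> * M k\<bar> \<le> \<bar>\<sigma>\<bar> / 2 * M k" using elim(1) z by blast
        then have "\<sigma> / 2 * M k \<le> L k z" 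
          using abs_ge_minus_self[of "L k z - \<sigma> * M k"] \<sigma> by simp
        then have "2 * pi * (\<sigma> / 2 * M k) \<le> 2 * pi * L k z" by (rule mult_left_mono) simp
        then have "M k * (pi * \<sigma>) \<le> 2 * pi * L k z" by (simp add: mult_ac)
        moreover have "- ln e < M k * (pi * \<sigma>)"
          using elim(2) unfolding pos_divide_less_eq[OF pos] .
        ultimately have "- (2 * pi * L k z) < ln e" by linarith
        then have "norm (f k z) < exp (ln e)" unfolding norm_f[OF z] exp_less_cancel_iff .
        then show "dist (f k z) 0 < e" using \<open>e > 0\<close> by simp
      qed
    qed
  qed
  then show ?thesis by (rule converges_on_uniform_limit[OF \<open>open U\<close>])
qed

section \<open>Zero-free functions whose 1-points are real\<close>

lemma exp_two_pi_i_int: "exp (2 * of_real pi * \<i> * of_int n) = 1"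
  using exp_integer_2pi[of "of_int n"] by (simp add: mult_ac)

text \<open>
  Integers can be subtracted from a logarithm divided by \<open>2 \<pi> i\<close>. The resulting bound on the real part
  at b rules out a nonzero real constant as the limit of the normalised functions.
\<close>
lemma log_over_two_pi_i:
  assumes "f holomorphic_on S" "convex S" "\<And>z. z \<in> S \<Longrightarrow> f z \<noteq> 0"
  obtains g where "g holomorphic_on S" "\<And>z. z \<in> S \<Longrightarrow> f z = exp (2 * of_real pi * \<i> * g z)"
    "0 \<le> Re (g b)" "Re (g b) \<le> 1"
proof -
  obtain l where l: "l holomorphic_on S" "\<And>z. z \<in> S \<Longrightarrow> f z = exp (l z)"
    using contractible_imp_holomorphic_log[OF assms(1) convex_imp_contractible[OF assms(2)] assms(3)] by blast
  define n where "n = \<lfloor>Re (l b / (2 * of_real pi * \<i>))\<rfloor>"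
  define g where "g = (\<lambda>z. l z / (2 * of_real pi * \<i>) - of_int n)"
  show ?thesis
  proof (rule that[of g])
    show "g holomorphic_on S" unfolding g_def by (intro holomorphic_intros l) auto
    fix z assume "z \<in> S"
    have "2 * of_real pi * \<i> * g z = l z - 2 * of_real pi * \<i> * of_int n"
      by (simp add: g_def algebra_simps)
    then show "f z = exp (2 * of_real pi * \<i> * g z)"
      using l(2)[OF \<open>z \<in> S\<close>] by (simp only: exp_diff exp_two_pi_i_int div_by_1)
  next
    have "Re (g b) = Re (l b / (2 * of_real pi * \<i>)) - of_int n" by (simp add: g_def)
    then show "0 \<le> Re (g b)" "Re (g b) \<le> 1" unfolding n_def by linarith+
  qed
qed

lemma norm_exp_two_pi_i: "norm (exp (2 * of_real pi * \<i> * w)) = exp (- (2 * pi * Im w))"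
  by (simp add: norm_exp_eq_Re)

text \<open>
  One good pair of k and a is enough: the hypotheses pass to subsequences, so applying this to a
  subsequence of counterexamples gives the conclusion for all large k.
\<close>
lemma good_one_point_exists:
  assumes "0 < r" "r < R" "0 < \<epsilon>"
    and hol: "\<And>k. F k holomorphic_on ball 0 R"
    and nz: "\<And>k z. z \<in> ball 0 R \<Longrightarrow> F k z \<noteq> 0"
    and one: "\<And>k z. z \<in> ball 0 R \<Longrightarrow> F k z = 1 \<Longrightarrow> Im z = 0"
    and div: "\<And>(s :: nat \<Rightarrow> nat) \<delta>. strict_mono s \<Longrightarrow> 0 < \<delta> \<Longrightarrow> \<delta> \<le> R \<Longrightarrow> \<not> converges_on (F \<circ> s) (ball 0 \<delta>)"
  shows "\<exists>k a. norm a < \<epsilon> \<and> F k a = 1 \<and>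
           (\<forall>y::real. y \<noteq> 0 \<and> norm (a + \<i> * of_real y) \<le> r \<longrightarrow> norm (F k (a + \<i> * of_real y)) \<noteq> 1)"
proof -
  define b where "b = \<i> * complex_of_real (R / 2)"
  have "\<exists>g. g holomorphic_on ball 0 R \<and> (\<forall>z\<in>ball 0 R. F k z = exp (2 * of_real pi * \<i> * g z))
      \<and> 0 \<le> Re (g b) \<and> Re (g b) \<le> 1" for k
    using log_over_two_pi_i[OF hol[of k] convex_ball nz[of _ k], where b = b] by metis
  then obtain g where g: "\<And>k. g k holomorphic_on ball 0 R"
      "\<And>k z. z \<in> ball 0 R \<Longrightarrow> F k z = exp (2 * of_real pi * \<i> * g k z)"
      "\<And>k. 0 \<le> Re (g k b)" "\<And>k. Re (g k b) \<le> 1"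
    by metis
  have norm_F: "norm (F k z) = exp (- (2 * pi * Im (g k z)))" if "z \<in> ball 0 R" for k z
    using g(2)[OF that] norm_exp_two_pi_i by metis
  have F_int: "F k z = 1" if "z \<in> ball 0 R" "g k z \<in> \<int>" for k z
    using g(2)[OF that(1), of k] exp_two_pi_i_int that(2) by (auto elim!: Ints_cases)
  have g_re: "Im z = 0" if "z \<in> ball 0 R" "g k z \<in> \<int>" for k z
    using one F_int that by blast
  define M where "M = (\<lambda>k. norm (g k b) + norm (g k (- b)) + 1)"
  have M1: "M k \<ge> 1" for k by (simp add: M_def)
  have M0: "M k > 0" for k using M1[of k] by linarith
  define \<rho> where "\<rho> = (r + R) / 2"
  have \<rho>: "0 < \<rho>" "r < \<rho>" "\<rho> < R" "R / 2 < \<rho>" using assms by (auto simp: \<rho>_def)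
  have \<rho>_sub: "ball 0 \<rho> \<subseteq> ball (0::complex) R" using \<rho> by auto
  obtain A where A: "A > 0" "\<And>k z. norm z \<le> \<rho> \<Longrightarrow> norm (g k z) \<le> A * M k"
  proof -
    obtain A where "A > 0"
      "\<And>h z. \<lbrakk>h holomorphic_on ball 0 R; \<And>z. z \<in> ball 0 R \<Longrightarrow> h z \<in> \<int> \<Longrightarrow> Im z = 0;
        norm z \<le> \<rho>\<rbrakk> \<Longrightarrow> norm (h z) \<le> A * (norm (h b) + norm (h (- b)) + 1)"
      unfolding b_def by (rule bound_across_real_axis[OF \<rho>(1,3)]) blast
    then show ?thesis using that g(1) g_re unfolding M_def by metis
  qed
  \<comment> \<open>otherwise the functions F would be locally bounded along a subsequence\<close>
  have M_inf: "filterlim M at_top sequentially"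
  proof (rule ccontr)
    assume "\<not> ?thesis"
    then obtain Z where "\<not> (\<forall>\<^sub>F k in sequentially. Z \<le> M k)" by (auto simp: filterlim_at_top)
    then obtain s :: "nat \<Rightarrow> nat" where s: "strict_mono s" "\<And>k. M (s k) < Z"
      using not_eventually_sequentiallyD by (metis not_le)
    have "norm (F (s k) z) \<le> exp (2 * pi * (A * Z))" if z: "norm z < \<rho>" for k z
    proof -
      have "- Im (g (s k) z) \<le> norm (g (s k) z)" using abs_Im_le_cmod[of "g (s k) z"] by linarith
      also have "\<dots> \<le> A * M (s k)" using z by (intro A) auto
      also have "\<dots> \<le> A * Z" using A(1) s(2)[of k] by (intro mult_left_mono) auto
      finally have "2 * pi * - Im (g (s k) z) \<le> 2 * pi * (A * Z)" by (rule mult_left_mono) simp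
      then have "- (2 * pi * Im (g (s k) z)) \<le> 2 * pi * (A * Z)" by (simp only: mult_minus_right)
      moreover have "z \<in> ball 0 R" using z \<rho> by simp
      ultimately show ?thesis by (simp only: norm_F exp_le_cancel_iff)
    qed
    moreover have "F (s k) holomorphic_on ball 0 \<rho>" for k by (rule holomorphic_on_subset[OF hol \<rho>_sub])
    ultimately obtain t :: "nat \<Rightarrow> nat" where t: "strict_mono t" "converges_on ((\<lambda>k. F (s k)) \<circ> t) (ball 0 r)"
      using subsequence_converges_of_bounded[OF \<open>0 < r\<close> \<open>r < \<rho>\<close>, of "\<lambda>k. F (s k)"] by metis
    have "\<not> converges_on (F \<circ> (s \<circ> t)) (ball 0 r)"
      using assms s t by (intro div strict_mono_o) auto
    with t(2) show False by (simp add: o_def)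
  qed
  define H where "H = (\<lambda>k z. g k z / of_real (M k))"
  have norm_H: "norm (H k z) = norm (g k z) / M k" for k z
    using M0[of k] by (simp add: H_def norm_divide)
  obtain G s where G: "G holomorphic_on ball 0 \<rho>" and s: "strict_mono (s :: nat \<Rightarrow> nat)"
    and pw: "\<And>z. z \<in> ball 0 \<rho> \<Longrightarrow> (\<lambda>k. H (s k) z) \<longlonglongrightarrow> G z"
    and lim: "\<And>K. \<lbrakk>compact K; K \<subseteq> ball 0 \<rho>\<rbrakk> \<Longrightarrow> uniform_limit K (H \<circ> s) G sequentially"
  proof (rule Montel[of "ball 0 \<rho>" "range H" H])
    show "h holomorphic_on ball 0 \<rho>" if "h \<in> range H" for h
      using that M0 holomorphic_on_subset[OF g(1) \<rho>_sub]
      by (auto simp: H_def less_imp_neq[OF M0, symmetric] intro!: holomorphic_intros)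
    show "\<exists>B. \<forall>h\<in>range H. \<forall>z\<in>K. norm (h z) \<le> B" if "compact K" "K \<subseteq> ball 0 \<rho>" for K
    proof (intro exI[of _ A] ballI)
      fix h z assume "h \<in> range H" "z \<in> K"
      then obtain k where "h = H k" by auto
      moreover have "norm (g k z) \<le> A * M k" using that \<open>z \<in> K\<close> by (intro A) auto
      ultimately show "norm (h z) \<le> A" using M0[of k] by (simp add: norm_H pos_divide_le_eq)
    qed
  qed auto
  have Ms_inf: "filterlim (\<lambda>k. M (s k)) at_top sequentially"
    using filterlim_compose[OF M_inf filterlim_subseq[OF s]] .
  have G0: "Im (G 0) = 0"
  proof (rule ccontr)
    assume nzG: "Im (G 0) \<noteq> 0"
    define \<sigma> where "\<sigma> = Im (G 0)"
    have "isCont G 0"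
      using holomorphic_on_imp_continuous_on[OF G] \<rho> by (simp add: continuous_on_eq_continuous_at)
    moreover have "\<bar>\<sigma>\<bar> / 4 > 0" using nzG by (simp add: \<sigma>_def)
    ultimately obtain d where d: "d > 0" "\<And>z. dist z 0 < d \<Longrightarrow> dist (G z) (G 0) < \<bar>\<sigma>\<bar> / 4"
      unfolding continuous_at_eps_delta by blast
    define \<delta> where "\<delta> = min (d / 2) r"
    have \<delta>: "\<delta> > 0" "\<delta> < d" "\<delta> \<le> r" using d assms by (auto simp: \<delta>_def)
    have "uniform_limit (cball 0 \<delta>) (H \<circ> s) G sequentially" using \<delta> \<rho> by (intro lim) auto
    then have "\<forall>\<^sub>F k in sequentially. \<forall>z\<in>cball 0 \<delta>. dist ((H \<circ> s) k z) (G z) < \<bar>\<sigma>\<bar> / 4"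
      using \<open>\<bar>\<sigma>\<bar> / 4 > 0\<close> by (rule uniform_limitD)
    then have near: "\<forall>\<^sub>F k in sequentially. \<forall>z\<in>ball 0 \<delta>. \<bar>Im (g (s k) z) - \<sigma> * M (s k)\<bar> \<le> \<bar>\<sigma>\<bar> / 2 * M (s k)"
    proof eventually_elim
      case (elim k)
      show ?case
      proof
        fix z assume z: "z \<in> ball (0::complex) \<delta>"
        have "norm (H (s k) z - G z) < \<bar>\<sigma>\<bar> / 4" "norm (G z - G 0) < \<bar>\<sigma>\<bar> / 4"
          using elim d(2)[of z] z \<delta> by (auto simp: dist_norm)
        then have "norm (H (s k) z - G 0) \<le> \<bar>\<sigma>\<bar> / 2"
          using norm_triangle_ineq[of "H (s k) z - G z" "G z - G 0"] by simp
        then have "\<bar>Im (H (s k) z) - \<sigma>\<bar> \<le> \<bar>\<sigma>\<bar> / 2"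
          using abs_Im_le_cmod[of "H (s k) z - G 0"] by (simp add: \<sigma>_def)
        then have "\<bar>Im (H (s k) z) - \<sigma>\<bar> * M (s k) \<le> \<bar>\<sigma>\<bar> / 2 * M (s k)"
          using M0[of "s k"] by (intro mult_right_mono) auto
        also have "\<bar>Im (H (s k) z) - \<sigma>\<bar> * M (s k) = \<bar>(Im (H (s k) z) - \<sigma>) * M (s k)\<bar>"
          using M0[of "s k"] by (simp add: abs_mult)
        also have "(Im (H (s k) z) - \<sigma>) * M (s k) = Im (g (s k) z) - \<sigma> * M (s k)"
          using M0[of "s k"] by (simp add: H_def field_simps)
        finally show "\<bar>Im (g (s k) z) - \<sigma> * M (s k)\<bar> \<le> \<bar>\<sigma>\<bar> / 2 * M (s k)" .
      qed
    qed
    have "norm ((F \<circ> s) k z) = exp (- (2 * pi * Im (g (s k) z)))" if "z \<in> ball 0 \<delta>" for k z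
      using norm_F[of z "s k"] that \<delta> assms by simp
    then have "converges_on (F \<circ> s) (ball 0 \<delta>)"
      using nzG by (intro converges_on_of_log_modulus[OF open_ball Ms_inf _ _ near]) (simp_all add: \<sigma>_def)
    moreover have "\<not> converges_on (F \<circ> s) (ball 0 \<delta>)" using \<delta> assms by (intro div s) auto
    ultimately show False by simp
  qed
  \<comment> \<open>a constant limit would be real, and zero by the choice of the logarithms,
      but the moduli at \<open>\<plusminus> b\<close> add up to 1 in the limit\<close>
  have nonconst: "\<not> G constant_on ball 0 \<rho>"
  proof
    assume "G constant_on ball 0 \<rho>"
    moreover have b\<rho>: "b \<in> ball 0 \<rho>" "- b \<in> ball 0 \<rho>" using \<rho> assms by (auto simp: b_def norm_mult)
    ultimately have Gb: "G b = G 0" "G (- b) = G 0" using \<rho> by (auto simp: constant_on_def)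
    have invM: "(\<lambda>k. 1 / M (s k)) \<longlonglongrightarrow> 0"
      using tendsto_inverse_0_at_top[OF Ms_inf] by (simp add: inverse_eq_divide)
    have "(\<lambda>k. Re (H (s k) b)) \<longlonglongrightarrow> 0"
    proof (rule Lim_null_comparison[OF _ invM])
      have "norm (Re (H k b)) \<le> 1 / M k" for k
        using g(3,4)[of k] M0[of k] by (simp add: H_def divide_right_mono)
      then show "\<forall>\<^sub>F k in sequentially. norm (Re (H (s k) b)) \<le> 1 / M (s k)" by simp
    qed
    moreover have "(\<lambda>k. Re (H (s k) b)) \<longlonglongrightarrow> Re (G b)" by (intro tendsto_Re pw b\<rho>)
    ultimately have "Re (G b) = 0" using LIMSEQ_unique by blast
    then have "G 0 = 0" using G0 Gb by (simp add: complex_eq_iff)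
    then have "(\<lambda>k. norm (H (s k) b) + norm (H (s k) (- b)) + 1 / M (s k)) \<longlonglongrightarrow> norm (0::complex) + norm (0::complex) + 0"
      using pw[OF b\<rho>(1)] pw[OF b\<rho>(2)] Gb by (intro tendsto_add tendsto_norm invM) auto
    moreover have "norm (H k b) + norm (H k (- b)) + 1 / M k = 1" for k
    proof -
      have "norm (H k b) + norm (H k (- b)) + 1 / M k = M k / M k"
        unfolding norm_H add_divide_distrib[symmetric] by (simp only: M_def)
      then show ?thesis using M0[of k] by simp
    qed
    ultimately have "(\<lambda>k::nat. 1::real) \<longlonglongrightarrow> 0" by simp
    then show False using LIMSEQ_unique[OF tendsto_const] by fastforce
  qed
  have "\<forall>\<^sub>F k in sequentially. \<exists>a. norm a < min \<epsilon> R \<and> Im a = 0 \<and> g (s k) a \<in> \<int> \<and>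
      (\<forall>y::real. y \<noteq> 0 \<and> norm (a + \<i> * of_real y) \<le> r \<longrightarrow> Im (g (s k) (a + \<i> * of_real y)) \<noteq> 0)"
  proof (rule perpendicular_through_integer_point[OF \<open>0 < r\<close> \<open>r < \<rho>\<close> _ G _ _ Ms_inf _ nonconst G0])
    show "g (s k) holomorphic_on ball 0 \<rho>" for k by (rule holomorphic_on_subset[OF g(1) \<rho>_sub])
    show "uniform_limit K (\<lambda>k z. g (s k) z / of_real (M (s k))) G sequentially" if "compact K" "K \<subseteq> ball 0 \<rho>" for K
      using lim[OF that] by (simp add: H_def o_def)
    show "Im z = 0" if "z \<in> ball 0 \<rho>" "g (s k) z \<in> \<int>" for k z using that \<rho>_sub g_re by blast
  qed (use M0 assms in auto)
  then obtain k a where a: "norm a < min \<epsilon> R" "g (s k) a \<in> \<int>"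
      "\<And>y::real. y \<noteq> 0 \<Longrightarrow> norm (a + \<i> * of_real y) \<le> r \<Longrightarrow> Im (g (s k) (a + \<i> * of_real y)) \<noteq> 0"
    using eventually_happens'[OF sequentially_bot] by blast
  show ?thesis
  proof (intro exI[of _ "s k"] exI[of _ a] conjI allI impI)
    show "norm a < \<epsilon>" using a by simp
    show "F (s k) a = 1" using a by (intro F_int) auto
    fix y :: real assume "y \<noteq> 0 \<and> norm (a + \<i> * of_real y) \<le> r"
    then show "norm (F (s k) (a + \<i> * of_real y)) \<noteq> 1"
      using norm_F[of "a + \<i> * of_real y" "s k"] a(3)[of y] assms by simp
  qed
qed

section \<open>Change of coordinates and choice of the sequence\<close>

lemma open_affine_image:
  fixes c u :: complex
  assumes "u \<noteq> 0" "open V"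
  shows "open ((\<lambda>w. c + u * w) ` V)"
proof -
  have "(\<lambda>w. c + u * w) ` V = (\<lambda>z. (z - c) / u) -` V"
  proof (intro equalityI subsetI)
    fix z assume "z \<in> (\<lambda>z. (z - c) / u) -` V"
    then show "z \<in> (\<lambda>w. c + u * w) ` V" using \<open>u \<noteq> 0\<close> by (intro image_eqI[of _ _ "(z - c) / u"]) auto
  qed (use \<open>u \<noteq> 0\<close> in auto)
  moreover have "open ((\<lambda>z. (z - c) / u) -` V)"
    using \<open>u \<noteq> 0\<close> by (intro open_vimage \<open>open V\<close> continuous_intros) auto
  ultimately show ?thesis by simp
qed

lemma converges_on_affine:
  assumes "u \<noteq> 0" and conv: "converges_on (\<lambda>n w. f n (c + u * w)) U"
  shows "converges_on f ((\<lambda>w. c + u * w) ` U)"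
proof -
  obtain g where g: "\<forall>z\<in>U. \<exists>V. open V \<and> z \<in> V \<and> V \<subseteq> U \<and>
      (\<forall>e>0. \<forall>\<^sub>F n in sequentially. \<forall>w\<in>V. spherical_dist (Some (f n (c + u * w))) (g w) < e)"
    using conv unfolding converges_on_def by blast
  show ?thesis
    unfolding converges_on_def
  proof (intro exI[of _ "\<lambda>z. g ((z - c) / u)"] ballI)
    fix z assume "z \<in> (\<lambda>w. c + u * w) ` U"
    then obtain w where w: "w \<in> U" "z = c + u * w" by auto
    then obtain V where V: "open V" "w \<in> V" "V \<subseteq> U"
      "\<And>e. e > 0 \<Longrightarrow> \<forall>\<^sub>F n in sequentially. \<forall>w\<in>V. spherical_dist (Some (f n (c + u * w))) (g w) < e"
      using g by blast
    from open_affine_image[OF assms(1) V(1)] show "\<exists>V. open V \<and> z \<in> V \<and> V \<subseteq> (\<lambda>w. c + u * w) ` U \<and>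
        (\<forall>e>0. \<forall>\<^sub>F n in sequentially. \<forall>w\<in>V. spherical_dist (Some (f n w)) (g ((w - c) / u)) < e)"
      using V w \<open>u \<noteq> 0\<close> by (intro exI[of _ "(\<lambda>w. c + u * w) ` V"]) auto
  qed
qed

text \<open>
  The point \<open>a k\<close> is chosen among the points with property Q, as close to \<open>z0\<close> as possible up to
  \<open>1 / (k + 1)\<close>, since the infimum of the distances need not be attained.
\<close>
lemma sequence_of_points_from_eventually:
  fixes z0 :: "'a :: metric_space"
  assumes "\<And>e. e > 0 \<Longrightarrow> \<forall>\<^sub>F k in sequentially. \<exists>a. dist a z0 < e \<and> Q k a"
  obtains a where "a \<longlonglongrightarrow> z0" "\<forall>\<^sub>F k in sequentially. Q k (a k)"
proof -
  have ex: "\<exists>a. Q k a \<and> (\<forall>b. Q k b \<longrightarrow> dist a z0 \<le> dist b z0 + 1 / Suc k)" if "\<exists>a. Q k a" for k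
  proof -
    define I where "I = (INF a\<in>{a. Q k a}. dist a z0)"
    have bdd: "bdd_below ((\<lambda>a. dist a z0) ` {a. Q k a})" by (rule bdd_belowI[of _ 0]) auto
    have "\<exists>x \<in> (\<lambda>a. dist a z0) ` {a. Q k a}. x < I + 1 / Suc k"
      unfolding I_def by (rule cInf_lessD) (use that in auto)
    then obtain a where a: "Q k a" "dist a z0 < I + 1 / Suc k" by blast
    moreover have "I \<le> dist b z0" if "Q k b" for b
      unfolding I_def using that by (intro cINF_lower[OF bdd]) auto
    ultimately show ?thesis by (intro exI[of _ a]) force
  qed
  define a where "a = (\<lambda>k. SOME a. Q k a \<and> (\<forall>b. Q k b \<longrightarrow> dist a z0 \<le> dist b z0 + 1 / Suc k))"
  have a: "Q k (a k)" "dist (a k) z0 \<le> dist b z0 + 1 / Suc k" if "Q k b" for k b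
    using someI_ex[OF ex[of k]] that unfolding a_def by blast+
  show ?thesis
  proof
    show "\<forall>\<^sub>F k in sequentially. Q k (a k)"
      using assms[of 1] a(1) by (auto elim!: eventually_mono)
    show "a \<longlonglongrightarrow> z0"
    proof (rule tendstoI)
      fix e :: real assume "e > 0"
      then have "\<forall>\<^sub>F k in sequentially. \<exists>a. dist a z0 < e / 2 \<and> Q k a" by (intro assms) simp
      moreover have "\<forall>\<^sub>F k in sequentially. inverse (real (Suc k)) < e / 2"
        using \<open>e > 0\<close> by (intro order_tendstoD(2)[OF LIMSEQ_inverse_real_of_nat]) simp
      ultimately show "\<forall>\<^sub>F k in sequentially. dist (a k) z0 < e"
      proof eventually_elim
        case (elim k)
        then obtain b where "dist b z0 < e / 2" "Q k b" by blast
        then show ?case using a(2)[of k b] elim(2) unfolding inverse_eq_divide by linarith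
      qed
    qed
  qed
qed

lemma cball_subset_open_imp_larger_ball:
  fixes z0 :: "'a :: euclidean_space"
  assumes "cball z0 r \<subseteq> D" "open D" "r > 0"
  obtains R where "R > r" "ball z0 R \<subseteq> D"
proof -
  obtain e where e: "e > 0" "(\<Union>x\<in>cball z0 r. ball x e) \<subseteq> D"
    using compact_subset_open_imp_ball_epsilon_subset[OF compact_cball assms(2,1)] by blast
  have "ball z0 (r + e) \<subseteq> D"
  proof
    fix z assume z: "z \<in> ball z0 (r + e)"
    define x where "x = z0 + (r / (r + e)) *\<^sub>R (z - z0)"
    have re: "r + e > 0" using e assms by simp
    have n: "norm (z - z0) < r + e" using z by (simp add: dist_norm norm_minus_commute)
    have "dist z0 x = r / (r + e) * norm (z - z0)" using re assms by (simp add: x_def dist_norm)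
    also have "\<dots> \<le> r / (r + e) * (r + e)" using n re assms by (intro mult_left_mono) auto
    finally have x: "x \<in> cball z0 r" using re by simp
    have "z - x = (1 - r / (r + e)) *\<^sub>R (z - z0)" by (simp add: x_def algebra_simps)
    then have "z - x = (e / (r + e)) *\<^sub>R (z - z0)" using re by (simp add: field_simps)
    then have "dist x z = e / (r + e) * norm (z - z0)"
      using re e by (simp add: dist_norm norm_minus_commute[of x z])
    also have "\<dots> < e / (r + e) * (r + e)" using n re e by (intro mult_strict_left_mono) auto
    finally have "z \<in> ball x e" using re by simp
    with x show "z \<in> D" using e by blast
  qed
  then show ?thesis using that[of "r + e"] e by simp
qed

theorem proposition1p1:
  fixes D Dplus Dminus :: "complex set" and p v z0 :: complex
    and F :: "(complex \<Rightarrow> complex) set" and f :: "nat \<Rightarrow> complex \<Rightarrow> complex" and r :: real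
  assumes "domain D" and "v \<noteq> 0" and "divides p v D Dplus Dminus"
    and "\<forall>h\<in>F. h holomorphic_on D"
    and "\<forall>h\<in>F. \<forall>z\<in>D. h z \<noteq> 0"
    and "\<forall>h\<in>F. \<forall>z\<in>D. h z = 1 \<longrightarrow> z \<in> line p v"
    and "z0 \<in> D \<inter> line p v"
    and "\<not> normal_at F D z0"
    and "\<forall>k. f k \<in> F"
    and "\<not> (\<exists>s U. strict_mono (s :: nat \<Rightarrow> nat) \<and> open U \<and> z0 \<in> U \<and> U \<subseteq> D \<and>
               converges_on (f \<circ> s) U)"
    and "converges_on f Dplus"
    and "r > 0" and "cball z0 r \<subseteq> D"
  shows "\<exists>a :: nat \<Rightarrow> complex. a \<longlonglongrightarrow> z0 \<and>
    (\<forall>\<^sub>F k in sequentially. a k \<in> D \<and> f k (a k) = 1 \<and>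
       (\<forall>z \<in> (line (a k) (\<i> * v) \<inter> cball z0 r) - {a k}. norm (f k z) \<noteq> 1))"
proof -
  define Q where "Q = (\<lambda>k a. a \<in> D \<and> f k a = 1 \<and>
       (\<forall>z \<in> (line a (\<i> * v) \<inter> cball z0 r) - {a}. norm (f k z) \<noteq> 1))"
  have "open D" using \<open>domain D\<close> by (simp add: domain_def)
  then obtain R where R: "R > r" "ball z0 R \<subseteq> D"
    using cball_subset_open_imp_larger_ball \<open>r > 0\<close> \<open>cball z0 r \<subseteq> D\<close> by blast
  \<comment> \<open>coordinates in which z0 is the origin and the line is the real axis\<close>
  define u where "u = sgn v"
  have u: "u \<noteq> 0" "norm u = 1" using \<open>v \<noteq> 0\<close> by (auto simp: u_def norm_sgn sgn_zero_iff)
  have v_u: "v = of_real (norm v) * u" using \<open>v \<noteq> 0\<close> by (simp add: u_def sgn_eq)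
  define \<phi> where "\<phi> = (\<lambda>w. z0 + u * w)"
  have \<phi>_dist: "dist (\<phi> w) z0 = norm w" for w using u by (simp add: \<phi>_def dist_norm norm_mult)
  have \<phi>_image: "\<phi> ` ball 0 \<delta> \<subseteq> ball z0 \<delta>" for \<delta>
    using \<phi>_dist by (auto simp: dist_commute)
  have \<phi>_D: "\<phi> w \<in> D" if "w \<in> ball 0 R" for w using that \<phi>_image R by blast
  obtain t0 where t0: "z0 = p + of_real t0 * v" using assms(7) by (auto simp: line_def)
  have "\<forall>\<^sub>F k in sequentially. \<exists>a. dist a z0 < e \<and> Q k a" if "e > 0" for e
  proof (rule ccontr)
    assume "\<not> ?thesis"
    then obtain s :: "nat \<Rightarrow> nat" where s: "strict_mono s" "\<And>k a. dist a z0 < e \<Longrightarrow> \<not> Q (s k) a"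
      using not_eventually_sequentiallyD by blast
    define h where "h = (\<lambda>k w. f (s k) (\<phi> w))"
    have "\<exists>k a. norm a < min e R \<and> h k a = 1 \<and>
        (\<forall>y::real. y \<noteq> 0 \<and> norm (a + \<i> * of_real y) \<le> r \<longrightarrow> norm (h k (a + \<i> * of_real y)) \<noteq> 1)"
    proof (rule good_one_point_exists[OF \<open>r > 0\<close> \<open>R > r\<close>])
      show "0 < min e R" using \<open>e > 0\<close> \<open>r > 0\<close> R by simp
      fix k :: nat
      have "(f (s k) \<circ> \<phi>) holomorphic_on ball 0 R"
      proof (rule holomorphic_on_compose_gen)
        show "\<phi> holomorphic_on ball 0 R" unfolding \<phi>_def by (intro holomorphic_intros)
        show "f (s k) holomorphic_on D" using assms(4,9) by blast
      qed (use \<phi>_D in auto)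
      then show "h k holomorphic_on ball 0 R" by (simp add: h_def o_def)
      fix w assume w: "w \<in> ball (0::complex) R"
      show "h k w \<noteq> 0" using assms(5,9) \<phi>_D[OF w] by (simp add: h_def)
      assume "h k w = 1"
      then have "\<phi> w \<in> line p v" 
        using assms(6)[rule_format, of "f (s k)" "\<phi> w"] assms(9) \<phi>_D[OF w] by (simp add: h_def)
      then obtain t where "\<phi> w = p + of_real t * v" by (auto simp: line_def)
      then have "u * w = of_real (t - t0) * v" by (simp add: \<phi>_def t0 algebra_simps)
      also have "\<dots> = u * of_real ((t - t0) * norm v)" by (subst v_u) simp
      finally have "w = of_real ((t - t0) * norm v)" using u(1) by (metis mult_left_cancel)
      then show "Im w = 0" by simp
    next
      fix t :: "nat \<Rightarrow> nat" and \<delta> :: real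
      assume t: "strict_mono t" "0 < \<delta>" "\<delta> \<le> R"
      show "\<not> converges_on (h \<circ> t) (ball 0 \<delta>)"
      proof
        assume "converges_on (h \<circ> t) (ball 0 \<delta>)"
        then have "converges_on (f \<circ> (s \<circ> t)) (\<phi> ` ball 0 \<delta>)"
          unfolding \<phi>_def
          by (intro converges_on_affine[OF u(1)]) (simp add: h_def \<phi>_def o_def)
        moreover have "strict_mono (s \<circ> t)" using s t by (intro strict_mono_o)
        moreover have "open (\<phi> ` ball 0 \<delta>)"
          unfolding \<phi>_def by (rule open_affine_image[OF u(1) open_ball])
        moreover have "z0 \<in> \<phi> ` ball 0 \<delta>" using t by (auto simp: \<phi>_def intro!: image_eqI[of _ _ 0])
        moreover have "\<phi> ` ball 0 \<delta> \<subseteq> D" using t \<phi>_D by auto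
        ultimately show False using assms(10) by blast
      qed
    qed
    then obtain k a where a: "norm a < min e R" "h k a = 1"
      "\<And>y::real. y \<noteq> 0 \<Longrightarrow> norm (a + \<i> * of_real y) \<le> r \<Longrightarrow> norm (h k (a + \<i> * of_real y)) \<noteq> 1"
      by blast
    have "Q (s k) (\<phi> a)"
      unfolding Q_def
    proof (intro conjI ballI)
      show "\<phi> a \<in> D" using a \<phi>_D by simp
      show "f (s k) (\<phi> a) = 1" using a by (simp add: h_def)
      fix z assume z: "z \<in> line (\<phi> a) (\<i> * v) \<inter> cball z0 r - {\<phi> a}"
      then obtain t where t: "z = \<phi> a + of_real t * (\<i> * v)" by (auto simp: line_def)
      have "of_real t * (\<i> * v) = u * (\<i> * of_real (t * norm v))" by (subst v_u) simp
      then have z_eq: "z = \<phi> (a + \<i> * of_real (t * norm v))" by (simp add: t \<phi>_def algebra_simps)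
      moreover have "t * norm v \<noteq> 0" using z t \<open>v \<noteq> 0\<close> by auto
      moreover have "norm (a + \<i> * of_real (t * norm v)) \<le> r"
        using z \<phi>_dist z_eq by (metis DiffD1 IntD2 dist_commute mem_cball)
      ultimately show "norm (f (s k) z) \<noteq> 1" using a(3)[of "t * norm v"] by (simp add: h_def)
    qed
    moreover have "dist (\<phi> a) z0 < e" using a \<phi>_dist by simp
    ultimately show False using s(2) by blast
  qed
  then obtain a where "a \<longlonglongrightarrow> z0" "\<forall>\<^sub>F k in sequentially. Q k (a k)"
    by (rule sequence_of_points_from_eventually) blast
  then show ?thesis unfolding Q_def by blast
qed

end
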